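(* Let $S=(X,\{(V_i,C_i)\}_{i=1}^m)$ be a $k$-ary constraint system and let $\pi$ be a symmetric probability distribution on $[m]\times[m]$ (i.e. $\pi(i,j)=\pi(j,i)$). There is a $4L$-homomorphism $\alpha:\mathcal{A}_{c-c}(S,\pi)\to\mathcal{A}_{c-v}(S,\pi')$, where $\pi'(i)=\sum_j\pi(i,j)$ and $L=\max_i|V_i|$.
   Context: A $k$-ary constraint system is $S=(X,\{(V_i,C_i)\}_{i=1}^m)$ with $X$ a finite set of variables, $V_i\subseteq X$, $C_i\subseteq\mathbb{Z}_k^{V_i}$, $\mathbb{Z}_k=\{0,\dots,k-1\}$. Algebras. $*$-algebras are complex and unital. $\mathbb{C}\mathbb{Z}_k^{*X}$ is the $*$-algebra generated by unitaries $x\in X$ with $x^k=1$; $\mathbb{C}\mathbb{Z}_k^V$ is its abelian analogue. $\Pi_a(x)=\frac1k\sum_{n=0}^{k-1}\omega_k^{-na}x^n$, $\omega_k=e^{2\pi i/k}$; $\Phi_{V,\phi}=\prod_{x\in V}\Pi_{\phi(x)}(x)$ for $\phi\in\mathbb{Z}_k^V$; $\mathcal{A}(V,C)=\mathbb{C}\mathbb{Z}_k^V/\langle\Phi_{V,\phi}:\phi\notin C\rangle$. A weighted $*$-algebra $(\mathcal{A},\mu)$ is a $*$-algebra with a finitely supported weight function $\mu:\mathcal{A}\to[0,\infty)$; below, weights of coinciding listed elements are added, and $\Phi_{V_i,\phi}$ also denotes its image under the inclusion of the $i$th free factor. - $\mathcal{A}_{c-c}(S,\pi)$, for $\pi$ a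 probability distribution on $[m]\times[m]$: the free product $\mathcal{A}_{c-c}(S)$ of the $\mathcal{A}(V_i,C_i)$, with weight $\pi(i,j)$ on $\Phi_{V_i,\phi}\Phi_{V_j,\psi}$ for $\phi\in C_i,\psi\in C_j$ with $\phi|_{V_i\cap V_j}\ne\psi|_{V_i\cap V_j}$, and $0$ elsewhere. - $\mathcal{A}_{c-v}(S,\pi')$, for $\pi'$ a probability distribution on $[m]$: the free product of all $\mathcal{A}(V_i,C_i)$ and $\mathbb{C}\mathbb{Z}_k^{*X}$ (with inclusion $\sigma'$ of $\mathbb{C}\mathbb{Z}_k^{*X}$), with weight $\pi'(i)/|V_i|$ on $\Phi_{V_i,\phi}(1-\Pi_{\phi(x)}(\sigma'(x)))$ for $i\in[m]$, $x\in V_i$, $\phi\in C_i$, and $0$ elsewhere. $a\lesssim b$ means $b-a=\sum_jc_j^*c_j+\sum_l(f_lg_l-g_lf_l)$ for finitely many elements. A $C$-homomorphism $(\mathcal{A},\mu)\to(\mathcal{B},\nu)$ is a $*$-homomorphism $\alpha:\mathcal{A}\to\mathcal{B}$ with $\alpha(\sum_a\mu(a)a^*a)\lesssim C\sum_b\nu(b)b^*b$. *)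

theory Defs
  imports
    "HOL-Algebra.QuotRing"
    "HOL-Algebra.Algebraic_Closure_Type"
    "HOL-Library.Poly_Mapping"
    "HOL-Library.FuncSet"
    "HOL-Probability.Probability_Mass_Function"
begin

section \<open>Unital complex *-algebras\<close>

record 'a star_algebra = "(complex, 'a) module" +
  adj :: "'a \<Rightarrow> 'a"

locale star_algebra =
  ring A + module "ring_of_type_algebra :: complex ring" A
  for A :: "('a, 'm) star_algebra_scheme" (structure) +
  assumes smult_mult_left:
      "\<And>c x y. x \<in> carrier A \<Longrightarrow> y \<in> carrier A \<Longrightarrow>
        module.smult A c x \<otimes>\<^bsub>A\<^esub> y = module.smult A c (x \<otimes>\<^bsub>A\<^esub> y)"
    and smult_mult_right:
      "\<And>c x y. x \<in> carrier A \<Longrightarrow> y \<in> carrier A \<Longrightarrow>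
        x \<otimes>\<^bsub>A\<^esub> module.smult A c y = module.smult A c (x \<otimes>\<^bsub>A\<^esub> y)"
    and adj_closed: "\<And>x. x \<in> carrier A \<Longrightarrow> adj A x \<in> carrier A"
    and adj_adj: "\<And>x. x \<in> carrier A \<Longrightarrow> adj A (adj A x) = x"
    and adj_add: "\<And>x y. x \<in> carrier A \<Longrightarrow> y \<in> carrier A \<Longrightarrow>
        adj A (x \<oplus>\<^bsub>A\<^esub> y) = adj A x \<oplus>\<^bsub>A\<^esub> adj A y"
    and adj_mult: "\<And>x y. x \<in> carrier A \<Longrightarrow> y \<in> carrier A \<Longrightarrow>
        adj A (x \<otimes>\<^bsub>A\<^esub> y) = adj A y \<otimes>\<^bsub>A\<^esub> adj A x"
    and adj_smult: "\<And>c x. x \<in> carrier A \<Longrightarrow>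
        adj A (module.smult A c x) = module.smult A (cnj c) (adj A x)"

text \<open>Membership in \<^const>\<open>ring_hom\<close> includes preservation of the unit.\<close>

definition star_hom ::
  "('a, 'm) star_algebra_scheme \<Rightarrow> ('b, 'n) star_algebra_scheme \<Rightarrow> ('a \<Rightarrow> 'b) \<Rightarrow> bool"
where
  "star_hom A B \<alpha> \<longleftrightarrow> \<alpha> \<in> ring_hom A B \<and>
     (\<forall>c. \<forall>x\<in>carrier A. \<alpha> (module.smult A c x) = module.smult B c (\<alpha> x)) \<and>
     (\<forall>x\<in>carrier A. \<alpha> (adj A x) = adj B (\<alpha> x))"

definition star_ideal :: "('a, 'm) star_algebra_scheme \<Rightarrow> 'a set \<Rightarrow> 'a set" where
  "star_ideal A R = \<Inter>{I. ideal I A \<and> R \<subseteq> I \<and> (\<forall>x\<in>I. adj A x \<in> I)}"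

text \<open>The ring part is the library's \<^const>\<open>FactRing\<close>; the coset of \<open>x\<close> is \<open>J +>\<^bsub>A\<^esub> x\<close>.\<close>

definition star_quot :: "('a, 'm) star_algebra_scheme \<Rightarrow> 'a set \<Rightarrow> 'a set star_algebra" where
  "star_quot A J =
     \<lparr> carrier = carrier (A Quot J), monoid.mult = monoid.mult (A Quot J),
       one = one (A Quot J), ring.zero = ring.zero (A Quot J), add = add (A Quot J),
       module.smult = (\<lambda>c Y. \<Union>y\<in>Y. J +>\<^bsub>A\<^esub> module.smult A c y),
       adj = (\<lambda>Y. \<Union>y\<in>Y. J +>\<^bsub>A\<^esub> adj A y) \<rparr>"


section \<open>Free *-algebras and presentations\<close>

text \<open>A letter \<open>(g, False)\<close> is the generator \<open>g\<close>, and \<open>(g, True)\<close> is its adjoint. Words form a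
  monoid, written additively so that the convolution product of
  \<^theory>\<open>HOL-Library.Poly_Mapping\<close> is the product of the monoid algebra.\<close>

datatype 'g word = Word "('g \<times> bool) list"

fun letters :: "'g word \<Rightarrow> ('g \<times> bool) list" where
  "letters (Word w) = w"

instantiation word :: (type) monoid_add
begin
definition zero_word :: "'g word" where "zero_word = Word []"
definition plus_word :: "'g word \<Rightarrow> 'g word \<Rightarrow> 'g word" where
  "plus_word u v = Word (letters u @ letters v)"
instance
proof
  fix a b c :: "'g word"
  show "a + b + c = a + (b + c)" by (simp add: plus_word_def)
  show "0 + a = a" by (cases a) (simp add: plus_word_def zero_word_def)
  show "a + 0 = a" by (cases a) (simp add: plus_word_def zero_word_def)
qed
end

type_synonym 'g free = "'g word \<Rightarrow>\<^sub>0 complex"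

definition adj_word :: "'g word \<Rightarrow> 'g word" where
  "adj_word w = Word (rev (map (\<lambda>(g, s). (g, \<not> s)) (letters w)))"

definition adj_free :: "'g free \<Rightarrow> 'g free" where
  "adj_free f =
     (\<Sum>w\<in>Poly_Mapping.keys f. Poly_Mapping.single (adj_word w) (cnj (Poly_Mapping.lookup f w)))"

definition gen :: "'g \<Rightarrow> 'g free" where
  "gen g = Poly_Mapping.single (Word [(g, False)]) 1"

definition free_star_algebra :: "'g set \<Rightarrow> 'g free star_algebra" where
  "free_star_algebra G =
     \<lparr> carrier = {f. \<forall>w\<in>Poly_Mapping.keys f. fst ` set (letters w) \<subseteq> G},
       monoid.mult = (*), one = 1, ring.zero = 0, add = (+),
       module.smult = (\<lambda>c f. Poly_Mapping.map ((*) c) f),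
       adj = adj_free \<rparr>"

definition presented :: "'g set \<Rightarrow> 'g free set \<Rightarrow> 'g free set star_algebra" where
  "presented G R = star_quot (free_star_algebra G) (star_ideal (free_star_algebra G) R)"

definition presented_gen :: "'g set \<Rightarrow> 'g free set \<Rightarrow> 'g \<Rightarrow> 'g free set" where
  "presented_gen G R g =
     star_ideal (free_star_algebra G) R +>\<^bsub>free_star_algebra G\<^esub> gen g"


section \<open>Free products\<close>

text \<open>The relations saying that \<open>a \<mapsto> gen (e a)\<close> is a unital *-homomorphism on \<open>A\<close>.\<close>

definition hom_relations ::
  "('a, 'm) star_algebra_scheme \<Rightarrow> ('a \<Rightarrow> 'g) \<Rightarrow> 'g free set"
where
  "hom_relations A e =
     {gen (e (a \<oplus>\<^bsub>A\<^esub> b)) - (gen (e a) + gen (e b)) | a b. a \<in> carrier A \<and> b \<in> carrier A} \<union>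
     {gen (e (a \<otimes>\<^bsub>A\<^esub> b)) - gen (e a) * gen (e b) | a b. a \<in> carrier A \<and> b \<in> carrier A} \<union>
     {gen (e (module.smult A c a)) - Poly_Mapping.map ((*) c) (gen (e a)) | c a. a \<in> carrier A} \<union>
     {gen (e (adj A a)) - adj_free (gen (e a)) | a. a \<in> carrier A} \<union>
     {gen (e \<one>\<^bsub>A\<^esub>) - 1}"

text \<open>The free product (coproduct of unital *-algebras) of the family \<open>A i\<close>, \<open>i \<in> I\<close>: generated by
  the disjoint union of the carriers, subject to the inclusions being unital *-homomorphisms.\<close>

definition fp_generators :: "'i set \<Rightarrow> ('i \<Rightarrow> 'a star_algebra) \<Rightarrow> ('i \<times> 'a) set" where
  "fp_generators I A = (SIGMA i:I. carrier (A i))"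

definition fp_relations :: "'i set \<Rightarrow> ('i \<Rightarrow> 'a star_algebra) \<Rightarrow> ('i \<times> 'a) free set" where
  "fp_relations I A = (\<Union>i\<in>I. hom_relations (A i) (\<lambda>a. (i, a)))"

definition free_product ::
  "'i set \<Rightarrow> ('i \<Rightarrow> 'a star_algebra) \<Rightarrow> ('i \<times> 'a) free set star_algebra"
where
  "free_product I A = presented (fp_generators I A) (fp_relations I A)"

definition fp_incl ::
  "'i set \<Rightarrow> ('i \<Rightarrow> 'a star_algebra) \<Rightarrow> 'i \<Rightarrow> 'a \<Rightarrow> ('i \<times> 'a) free set"
where
  "fp_incl I A i a = presented_gen (fp_generators I A) (fp_relations I A) (i, a)"

text \<open>The free product of the family \<open>A i\<close>, \<open>i \<in> I\<close>, together with one further factor \<open>B\<close>, whose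
  elements may have a different type.\<close>

definition fp1_generators ::
  "'i set \<Rightarrow> ('i \<Rightarrow> 'a star_algebra) \<Rightarrow> 'b star_algebra \<Rightarrow> ('i \<times> 'a + 'b) set"
where
  "fp1_generators I A B = Inl ` (SIGMA i:I. carrier (A i)) \<union> Inr ` carrier B"

definition fp1_relations ::
  "'i set \<Rightarrow> ('i \<Rightarrow> 'a star_algebra) \<Rightarrow> 'b star_algebra \<Rightarrow> ('i \<times> 'a + 'b) free set"
where
  "fp1_relations I A B =
     (\<Union>i\<in>I. hom_relations (A i) (\<lambda>a. Inl (i, a))) \<union> hom_relations B Inr"

definition free_product1 ::
  "'i set \<Rightarrow> ('i \<Rightarrow> 'a star_algebra) \<Rightarrow> 'b star_algebra \<Rightarrow> ('i \<times> 'a + 'b) free set star_algebra"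
where
  "free_product1 I A B = presented (fp1_generators I A B) (fp1_relations I A B)"

definition fp1_incl ::
  "'i set \<Rightarrow> ('i \<Rightarrow> 'a star_algebra) \<Rightarrow> 'b star_algebra \<Rightarrow> 'i \<Rightarrow> 'a \<Rightarrow> ('i \<times> 'a + 'b) free set"
where
  "fp1_incl I A B i a = presented_gen (fp1_generators I A B) (fp1_relations I A B) (Inl (i, a))"

definition fp1_incl_last ::
  "'i set \<Rightarrow> ('i \<Rightarrow> 'a star_algebra) \<Rightarrow> 'b star_algebra \<Rightarrow> 'b \<Rightarrow> ('i \<times> 'a + 'b) free set"
where
  "fp1_incl_last I A B b = presented_gen (fp1_generators I A B) (fp1_relations I A B) (Inr b)"


section \<open>Weighted *-algebras\<close>

locale weighted_star_algebra = star_algebra A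
  for A :: "('a, 'm) star_algebra_scheme" (structure) and \<mu> :: "'a \<Rightarrow> real" +
  assumes weight_nonneg: "\<And>a. 0 \<le> \<mu> a"
    and weight_support: "finite {a. \<mu> a \<noteq> 0}" "{a. \<mu> a \<noteq> 0} \<subseteq> carrier A"

definition weighted_square_sum ::
  "('a, 'm) star_algebra_scheme \<Rightarrow> ('a \<Rightarrow> real) \<Rightarrow> 'a"
where
  "weighted_square_sum A \<mu> =
     (\<Oplus>\<^bsub>A\<^esub>a\<in>{a. \<mu> a \<noteq> 0}. module.smult A (of_real (\<mu> a)) (adj A a \<otimes>\<^bsub>A\<^esub> a))"

text \<open>\<open>b - a\<close> is a sum of hermitian squares plus a sum of commutators.\<close>

definition cyclic_le :: "('a, 'm) star_algebra_scheme \<Rightarrow> 'a \<Rightarrow> 'a \<Rightarrow> bool" where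
  "cyclic_le A a b \<longleftrightarrow>
     (\<exists>(n::nat) c (m::nat) f g.
        (\<forall>j<n. c j \<in> carrier A) \<and> (\<forall>l<m. f l \<in> carrier A \<and> g l \<in> carrier A) \<and>
        b \<ominus>\<^bsub>A\<^esub> a =
          (\<Oplus>\<^bsub>A\<^esub>j\<in>{..<n}. adj A (c j) \<otimes>\<^bsub>A\<^esub> c j) \<oplus>\<^bsub>A\<^esub>
          (\<Oplus>\<^bsub>A\<^esub>l\<in>{..<m}. (f l \<otimes>\<^bsub>A\<^esub> g l) \<ominus>\<^bsub>A\<^esub> (g l \<otimes>\<^bsub>A\<^esub> f l)))"

definition C_homomorphism ::
  "real \<Rightarrow> ('a, 'm) star_algebra_scheme \<Rightarrow> ('a \<Rightarrow> real) \<Rightarrow>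
   ('b, 'n) star_algebra_scheme \<Rightarrow> ('b \<Rightarrow> real) \<Rightarrow> ('a \<Rightarrow> 'b) \<Rightarrow> bool"
where
  "C_homomorphism C A \<mu> B \<nu> \<alpha> \<longleftrightarrow>
     weighted_star_algebra A \<mu> \<and> weighted_star_algebra B \<nu> \<and> star_hom A B \<alpha> \<and>
     cyclic_le B (\<alpha> (weighted_square_sum A \<mu>))
       (module.smult B (of_real C) (weighted_square_sum B \<nu>))"

text \<open>The weight function that puts weight \<open>w t\<close> on the element \<open>e t\<close> for each \<open>t \<in> T\<close>;
  weights of coinciding elements are added.\<close>

definition listed_weight :: "'t set \<Rightarrow> ('t \<Rightarrow> real) \<Rightarrow> ('t \<Rightarrow> 'a) \<Rightarrow> 'a \<Rightarrow> real" where
  "listed_weight T w e a = (\<Sum>t\<in>{t \<in> T. e t = a}. w t)"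


section \<open>Constraint systems\<close>

text \<open>The constraints are indexed by \<open>{1..ncons S}\<close>. An assignment to a scope \<open>V\<close> is an element
  of \<open>V \<rightarrow>\<^sub>E {0..<k}\<close>.\<close>

record 'v constraint_system =
  vars :: "'v set"
  ncons :: nat
  scope :: "nat \<Rightarrow> 'v set"
  sat :: "nat \<Rightarrow> ('v \<Rightarrow> nat) set"

locale kary_constraint_system =
  fixes k :: nat and S :: "'v constraint_system"
  assumes k_pos: "0 < k"
    and finite_vars: "finite (vars S)"
    and scope_vars: "\<And>i. i \<in> {1..ncons S} \<Longrightarrow> scope S i \<subseteq> vars S"
    and sat_scope: "\<And>i. i \<in> {1..ncons S} \<Longrightarrow> sat S i \<subseteq> scope S i \<rightarrow>\<^sub>E {0..<k}"

definition unitary_relations :: "nat \<Rightarrow> 'v set \<Rightarrow> 'v free set" where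
  "unitary_relations k V =
     (\<Union>x\<in>V. {adj_free (gen x) * gen x - 1, gen x * adj_free (gen x) - 1, gen x ^ k - 1})"

definition commutation_relations :: "'v set \<Rightarrow> 'v free set" where
  "commutation_relations V = {gen x * gen y - gen y * gen x | x y. x \<in> V \<and> y \<in> V}"

definition CZ_free :: "nat \<Rightarrow> 'v set \<Rightarrow> 'v free set star_algebra" where
  "CZ_free k V = presented V (unitary_relations k V)"

definition CZ_free_gen :: "nat \<Rightarrow> 'v set \<Rightarrow> 'v \<Rightarrow> 'v free set" where
  "CZ_free_gen k V x = presented_gen V (unitary_relations k V) x"

definition CZ_abelian :: "nat \<Rightarrow> 'v set \<Rightarrow> 'v free set star_algebra" where
  "CZ_abelian k V = presented V (unitary_relations k V \<union> commutation_relations V)"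

definition CZ_abelian_gen :: "nat \<Rightarrow> 'v set \<Rightarrow> 'v \<Rightarrow> 'v free set" where
  "CZ_abelian_gen k V x = presented_gen V (unitary_relations k V \<union> commutation_relations V) x"

definition root_of_unity :: "nat \<Rightarrow> complex" where
  "root_of_unity k = exp (2 * of_real pi * \<i> / of_nat k)"

definition spectral_proj :: "nat \<Rightarrow> ('a, 'm) star_algebra_scheme \<Rightarrow> nat \<Rightarrow> 'a \<Rightarrow> 'a" where
  "spectral_proj k A a x =
     module.smult A (1 / of_nat k)
       (\<Oplus>\<^bsub>A\<^esub>n\<in>{0..<k}. module.smult A (root_of_unity k powi (- int (n * a))) (x [^]\<^bsub>A\<^esub> n))"

definition Phi_abelian :: "nat \<Rightarrow> 'v set \<Rightarrow> ('v \<Rightarrow> nat) \<Rightarrow> 'v free set" where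
  "Phi_abelian k V \<phi> =
     (\<Otimes>\<^bsub>CZ_abelian k V\<^esub>x\<in>V. spectral_proj k (CZ_abelian k V) (\<phi> x) (CZ_abelian_gen k V x))"

definition constraint_ideal :: "nat \<Rightarrow> 'v set \<Rightarrow> ('v \<Rightarrow> nat) set \<Rightarrow> 'v free set set" where
  "constraint_ideal k V C =
     star_ideal (CZ_abelian k V) (Phi_abelian k V ` ((V \<rightarrow>\<^sub>E {0..<k}) - C))"

definition constraint_algebra ::
  "nat \<Rightarrow> 'v set \<Rightarrow> ('v \<Rightarrow> nat) set \<Rightarrow> 'v free set set star_algebra"
where
  "constraint_algebra k V C = star_quot (CZ_abelian k V) (constraint_ideal k V C)"

definition Phi :: "nat \<Rightarrow> 'v set \<Rightarrow> ('v \<Rightarrow> nat) set \<Rightarrow> ('v \<Rightarrow> nat) \<Rightarrow> 'v free set set" where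
  "Phi k V C \<phi> = constraint_ideal k V C +>\<^bsub>CZ_abelian k V\<^esub> Phi_abelian k V \<phi>"

definition factor ::
  "nat \<Rightarrow> 'v constraint_system \<Rightarrow> nat \<Rightarrow> 'v free set set star_algebra"
where
  "factor k S i = constraint_algebra k (scope S i) (sat S i)"


subsection \<open>The constraint-constraint algebra\<close>

definition A_cc ::
  "nat \<Rightarrow> 'v constraint_system \<Rightarrow> (nat \<times> 'v free set set) free set star_algebra"
where
  "A_cc k S = free_product {1..ncons S} (factor k S)"

definition Phi_cc ::
  "nat \<Rightarrow> 'v constraint_system \<Rightarrow> nat \<Rightarrow> ('v \<Rightarrow> nat) \<Rightarrow> (nat \<times> 'v free set set) free set"
where
  "Phi_cc k S i \<phi> = fp_incl {1..ncons S} (factor k S) i (Phi k (scope S i) (sat S i) \<phi>)"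

definition weight_cc ::
  "nat \<Rightarrow> 'v constraint_system \<Rightarrow> (nat \<times> nat) pmf \<Rightarrow>
   (nat \<times> 'v free set set) free set \<Rightarrow> real"
where
  "weight_cc k S \<pi> =
     listed_weight
       {(i, j, \<phi>, \<psi>). i \<in> {1..ncons S} \<and> j \<in> {1..ncons S} \<and> \<phi> \<in> sat S i \<and> \<psi> \<in> sat S j \<and>
          restrict \<phi> (scope S i \<inter> scope S j) \<noteq> restrict \<psi> (scope S i \<inter> scope S j)}
       (\<lambda>(i, j, \<phi>, \<psi>). pmf \<pi> (i, j))
       (\<lambda>(i, j, \<phi>, \<psi>). Phi_cc k S i \<phi> \<otimes>\<^bsub>A_cc k S\<^esub> Phi_cc k S j \<psi>)"


subsection \<open>The constraint-variable algebra\<close>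

definition A_cv ::
  "nat \<Rightarrow> 'v constraint_system \<Rightarrow>
   (nat \<times> 'v free set set + 'v free set) free set star_algebra"
where
  "A_cv k S = free_product1 {1..ncons S} (factor k S) (CZ_free k (vars S))"

definition Phi_cv ::
  "nat \<Rightarrow> 'v constraint_system \<Rightarrow> nat \<Rightarrow> ('v \<Rightarrow> nat) \<Rightarrow>
   (nat \<times> 'v free set set + 'v free set) free set"
where
  "Phi_cv k S i \<phi> =
     fp1_incl {1..ncons S} (factor k S) (CZ_free k (vars S)) i (Phi k (scope S i) (sat S i) \<phi>)"

definition var_cv ::
  "nat \<Rightarrow> 'v constraint_system \<Rightarrow> 'v \<Rightarrow> (nat \<times> 'v free set set + 'v free set) free set"
where
  "var_cv k S x =
     fp1_incl_last {1..ncons S} (factor k S) (CZ_free k (vars S)) (CZ_free_gen k (vars S) x)"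

definition weight_cv ::
  "nat \<Rightarrow> 'v constraint_system \<Rightarrow> nat pmf \<Rightarrow>
   (nat \<times> 'v free set set + 'v free set) free set \<Rightarrow> real"
where
  "weight_cv k S \<pi>' =
     listed_weight
       {(i, x, \<phi>). i \<in> {1..ncons S} \<and> x \<in> scope S i \<and> \<phi> \<in> sat S i}
       (\<lambda>(i, x, \<phi>). pmf \<pi>' i / real (card (scope S i)))
       (\<lambda>(i, x, \<phi>). Phi_cv k S i \<phi> \<otimes>\<^bsub>A_cv k S\<^esub>
          (\<one>\<^bsub>A_cv k S\<^esub> \<ominus>\<^bsub>A_cv k S\<^esub> spectral_proj k (A_cv k S) (\<phi> x) (var_cv k S x)))"

end

(* Both algebras are quotients of free *-algebras, so everything is computed on representatives in
   the free algebra, modulo the kernel of the quotient map. The homomorphism is the inclusion of the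
   free factors. Let P_a, R_a, Q_a be the spectral projections of a variable x in the i-th factor, in
   the j-th factor and in the free variable algebra. Modulo commutators,
   4 E(P,Q) + 4 E(R,Q) - 2 E(P,R) is the sum of the squares (P_a - 2 Q_a + R_a)^2, where
   E(P,Q) = 1 - sum_a P_a Q_a. If phi and psi disagree on the common scope, they disagree at
   some common x, so the square of Phi_phi Phi_psi is counted in E(P,R) for that x. Summing over the
   common variables and over i, j with the symmetric weights gives the factor 4; the factor L comes
   from the normalisation by the size of the scope in the constraint-variable algebra. *)
theory Submission
  imports Defs
begin

text \<open>Modulo commutators 2 E(P,Q) is the sum of the squares (P_a - Q_a)^2, a squared distance
  between two measurements, and the identity behind the triangle inequality is the parallelogram law
  for P - Q and R - Q. Hence E(P,R) is at most 2 E(P,Q) + 2 E(R,Q); symmetric weights give both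
  halves the same total, and 2 + 2 = 4. The obstacle is that distinct free factors satisfy no joint
  relations: a product of projections from two factors is in general neither self-adjoint nor
  idempotent, and the order is not preserved by multiplication. What rescues the argument is that p
  r is cyclically equal to its own hermitian square. Every square in the two weighted sums can
  therefore be traded for an expression linear in each measurement, where marginals, union bounds
  and totals follow from distributivity. Representatives bring all of this into a type-class ring,
  so that sums and products can be simplified directly.\<close>

abbreviation sc :: "complex \<Rightarrow> 'g free" where
  "sc c \<equiv> Poly_Mapping.single 0 c"

abbreviation FA :: "'g set \<Rightarrow> 'g free set" where
  "FA G \<equiv> carrier (free_star_algebra G)"

section \<open>Finitely supported functions as sums of one-point functions\<close>

lemma poly_mapping_eq_sum_single:
  "f = (\<Sum>w\<in>Poly_Mapping.keys f. Poly_Mapping.single w (Poly_Mapping.lookup f w))"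
  by (rule poly_mapping_eqI)
    (auto simp: lookup_sum lookup_single when_def in_keys_iff)

text \<open>There is no separate case for zero, because zero is the one-point function with value 0.
  Identities that are additive in each argument are reduced by this rule to single words.\<close>

lemma poly_mapping_induct_single [case_names single add]:
  fixes f :: "'k \<Rightarrow>\<^sub>0 'c::comm_monoid_add"
  assumes single: "\<And>k c. P (Poly_Mapping.single k c)" and add: "\<And>f g. P f \<Longrightarrow> P g \<Longrightarrow> P (f + g)"
  shows "P f"
proof -
  have "P (\<Sum>w\<in>A. Poly_Mapping.single w (Poly_Mapping.lookup f w))" if "finite A" for A
    using that
  proof (induction A)
    case empty
    then show ?case using single[of undefined 0] by simp
  qed (simp add: single add)
  then show ?thesis
    using poly_mapping_eq_sum_single[of f] by (metis finite_keys)
qed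

subsection \<open>Scalars\<close>

lemma sc_central: "sc c * f = f * sc c"
  by (induction f rule: poly_mapping_induct_single) (simp_all add: mult_single algebra_simps)

lemma sc_mult: "sc a * sc b = sc (a * b)"
  by (simp add: mult_single)

lemma sc_mult_assoc: "sc a * (sc b * f) = sc (a * b) * f"
  by (simp add: mult_single flip: mult.assoc)

text \<open>The ring is not commutative, so scalars must be moved explicitly: this rule pulls a
  constant to the front, and \<open>sc_mult_assoc\<close> then merges it with the next one.\<close>

lemma sc_left_commute: "f * (sc c * g) = sc c * (f * g)"
  by (metis sc_central mult.assoc)

lemma sc_sum: "sc (\<Sum>i\<in>I. h i) = (\<Sum>i\<in>I. sc (h i))"
  by (rule poly_mapping_eqI) (simp add: lookup_sum lookup_single when_def)

lemma sc_numeral: "sc (numeral n) = numeral n"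
  by simp

subsection \<open>The adjoint\<close>

lemma adj_word_plus: "adj_word (u + v) = adj_word v + adj_word u"
  by (simp add: adj_word_def plus_word_def)

lemma adj_word_zero [simp]: "adj_word 0 = 0"
  by (simp add: adj_word_def zero_word_def)

lemma adj_word_adj_word [simp]: "adj_word (adj_word w) = w"
  by (cases w) (simp add: adj_word_def rev_map case_prod_unfold comp_def)

text \<open>Keys may cancel in \<open>f + g\<close>, so the sums over keys do not simply combine;
  what makes it work is that a key with coefficient 0 contributes 0.\<close>

lemma adj_free_add: "adj_free (f + g) = adj_free f + adj_free g"
  unfolding adj_free_def
  by (rule setsum_keys_plus_distrib) (simp_all add: single_add)

lemma adj_free_single: "adj_free (Poly_Mapping.single w c) = Poly_Mapping.single (adj_word w) (cnj c)"
  by (simp add: adj_free_def)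

lemma adj_free_sc [simp]: "adj_free (sc c) = sc (cnj c)"
  by (simp add: adj_free_single)

lemma adj_free_0 [simp]: "adj_free 0 = 0"
  by (simp add: adj_free_def)

lemma adj_free_1 [simp]: "adj_free 1 = 1"
  using adj_free_sc[of 1] by simp

lemma adj_free_mult: "adj_free (f * g) = adj_free g * adj_free f"
proof (induction f rule: poly_mapping_induct_single)
  case (single u c)
  show ?case
    by (induction g rule: poly_mapping_induct_single)
      (simp_all add: adj_free_add adj_free_single mult_single adj_word_plus algebra_simps)
qed (simp add: adj_free_add algebra_simps)

lemma adj_free_scale: "adj_free (sc c * f) = sc (cnj c) * adj_free f"
  unfolding adj_free_mult adj_free_sc by (rule sc_central[symmetric])

lemma adj_free_adj_free [simp]: "adj_free (adj_free f) = f"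
  by (induction f rule: poly_mapping_induct_single) (simp_all add: adj_free_add adj_free_single)

lemma adj_free_minus: "adj_free (- f) = - adj_free f"
  by (metis add.right_inverse add_eq_0_iff adj_free_0 adj_free_add)

lemma adj_free_diff: "adj_free (f - g) = adj_free f - adj_free g"
  using adj_free_add[of f "- g"] by (simp add: adj_free_minus)

lemma adj_free_sum: "adj_free (\<Sum>i\<in>I. h i) = (\<Sum>i\<in>I. adj_free (h i))"
  by (induction I rule: infinite_finite_induct) (simp_all add: adj_free_add)

lemma adj_free_power: "adj_free (f ^ n) = adj_free f ^ n"
  by (induction n) (simp_all add: adj_free_mult power_commutes)

subsection \<open>Renaming generators\<close>

definition map_word :: "('g \<Rightarrow> 'h) \<Rightarrow> 'g word \<Rightarrow> 'h word" where
  "map_word r w = Word (map (\<lambda>(g, s). (r g, s)) (letters w))"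

text \<open>Coefficients of words that become equal under \<open>r\<close> are added, so this is a
  homomorphism for every \<open>r\<close>. With \<open>r = Inl\<close> it induces the map between
  the two free products.\<close>

definition map_free :: "('g \<Rightarrow> 'h) \<Rightarrow> 'g free \<Rightarrow> 'h free" where
  "map_free r f =
     (\<Sum>w\<in>Poly_Mapping.keys f. Poly_Mapping.single (map_word r w) (Poly_Mapping.lookup f w))"

lemma map_word_plus: "map_word r (u + v) = map_word r u + map_word r v"
  by (simp add: map_word_def plus_word_def)

lemma map_word_zero [simp]: "map_word r 0 = 0"
  by (simp add: map_word_def zero_word_def)

lemma map_word_adj_word: "map_word r (adj_word w) = adj_word (map_word r w)"
  by (simp add: map_word_def adj_word_def rev_map case_prod_unfold comp_def)

lemma map_free_add: "map_free r (f + g) = map_free r f + map_free r g"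
  unfolding map_free_def
  by (rule setsum_keys_plus_distrib) (simp_all add: single_add)

lemma map_free_single: "map_free r (Poly_Mapping.single w c) = Poly_Mapping.single (map_word r w) c"
  by (simp add: map_free_def)

lemma map_free_0 [simp]: "map_free r 0 = 0"
  by (simp add: map_free_def)

lemma map_free_1 [simp]: "map_free r 1 = 1"
  using map_free_single[of r 0 1] by simp

lemma map_free_mult: "map_free r (f * g) = map_free r f * map_free r g"
proof (induction f rule: poly_mapping_induct_single)
  case (single u c)
  show ?case
    by (induction g rule: poly_mapping_induct_single)
      (simp_all add: map_free_add map_free_single mult_single map_word_plus algebra_simps)
qed (simp add: map_free_add algebra_simps)

lemma map_free_diff: "map_free r (f - g) = map_free r f - map_free r g"
  by (metis add_diff_cancel_right' diff_add_cancel map_free_add)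

lemma map_free_adj: "map_free r (adj_free f) = adj_free (map_free r f)"
  by (induction f rule: poly_mapping_induct_single)
    (simp_all add: adj_free_add adj_free_single map_free_add map_free_single map_word_adj_word)

lemma map_free_gen [simp]: "map_free r (gen g) = gen (r g)"
  by (simp add: gen_def map_free_single map_word_def)

subsection \<open>The free algebra on a set of generators\<close>

lemma FA_iff: "f \<in> FA G \<longleftrightarrow> (\<forall>w\<in>Poly_Mapping.keys f. fst ` set (letters w) \<subseteq> G)"
  by (simp add: free_star_algebra_def)

text \<open>The record operations become type-class operations, and the scalar action becomes
  multiplication by a constant, so the ring laws of the type take over.\<close>

lemma free_star_algebra_simps [simp]:
  "monoid.mult (free_star_algebra G) = (*)" "one (free_star_algebra G) = 1"
  "ring.zero (free_star_algebra G) = 0" "add (free_star_algebra G) = (+)"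
  "module.smult (free_star_algebra G) = (\<lambda>c f. sc c * f)"
  "adj (free_star_algebra G) = adj_free"
  by (simp_all add: free_star_algebra_def mult_map_scale_conv_mult fun_eq_iff)

lemma FA_single: "fst ` set (letters w) \<subseteq> G \<Longrightarrow> Poly_Mapping.single w c \<in> FA G"
  by (simp add: FA_iff)

lemma FA_0 [simp]: "0 \<in> FA G"
  by (simp add: FA_iff)

lemma FA_sc [simp]: "sc c \<in> FA G"
  by (rule FA_single) (simp add: zero_word_def)

lemma FA_1 [simp]: "1 \<in> FA G"
  using FA_sc[of 1] by simp

lemma FA_gen: "g \<in> G \<Longrightarrow> gen g \<in> FA G"
  unfolding gen_def by (rule FA_single) simp

lemma FA_add [simp]: "f \<in> FA G \<Longrightarrow> g \<in> FA G \<Longrightarrow> f + g \<in> FA G"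
  using keys_add[of f g] by (fastforce simp: FA_iff)

lemma FA_uminus [simp]: "f \<in> FA G \<Longrightarrow> - f \<in> FA G"
  by (simp add: FA_iff in_keys_iff)

lemma FA_diff [simp]: "f \<in> FA G \<Longrightarrow> g \<in> FA G \<Longrightarrow> f - g \<in> FA G"
  using FA_add[of f G "- g"] by simp

lemma FA_mult [simp]: "f \<in> FA G \<Longrightarrow> g \<in> FA G \<Longrightarrow> f * g \<in> FA G"
  using keys_mult[of f g] by (fastforce simp: FA_iff plus_word_def image_Un)

lemma FA_power [simp]: "f \<in> FA G \<Longrightarrow> f ^ n \<in> FA G"
  by (induction n) simp_all

lemma FA_sum [simp]: "(\<And>i. i \<in> I \<Longrightarrow> h i \<in> FA G) \<Longrightarrow> (\<Sum>i\<in>I. h i) \<in> FA G"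
  by (induction I rule: infinite_finite_induct) simp_all

lemma FA_prod_list: "(\<And>x. x \<in> set xs \<Longrightarrow> h x \<in> FA G) \<Longrightarrow> (\<Prod>x\<leftarrow>xs. h x) \<in> FA G"
  by (induction xs) simp_all

text \<open>Every partial sum of \<open>f\<close> has its keys among those of \<open>f\<close>, so
  the induction never leaves the subalgebra and the additive case may assume membership.\<close>

lemma FA_induct [consumes 1, case_names zero single add]:
  assumes "f \<in> FA G" and zero: "P 0"
    and single: "\<And>w c. fst ` set (letters w) \<subseteq> G \<Longrightarrow> P (Poly_Mapping.single w c)"
    and add: "\<And>f g. f \<in> FA G \<Longrightarrow> g \<in> FA G \<Longrightarrow> P f \<Longrightarrow> P g \<Longrightarrow> P (f + g)"
  shows "P f"
proof -
  have "P (\<Sum>w\<in>A. Poly_Mapping.single w (Poly_Mapping.lookup f w))"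
    if "finite A" "A \<subseteq> Poly_Mapping.keys f" for A
    using that
  proof (induction A)
    case (insert w A)
    then have *: "fst ` set (letters v) \<subseteq> G" if "v \<in> insert w A" for v
      using assms(1) that by (auto simp: FA_iff)
    then have "(\<Sum>v\<in>A. Poly_Mapping.single v (Poly_Mapping.lookup f v)) \<in> FA G"
      by (intro FA_sum FA_single) auto
    then show ?case
      using insert * by (simp add: add single FA_single)
  qed (simp add: zero)
  then show ?thesis
    using poly_mapping_eq_sum_single[of f] by (metis finite_keys subset_refl)
qed

lemma fst_letters_adj_word: "fst ` set (letters (adj_word w)) = fst ` set (letters w)"
  by (simp add: adj_word_def image_image case_prod_unfold)

lemma fst_letters_map_word: "fst ` set (letters (map_word r w)) = r ` fst ` set (letters w)"
  by (simp add: map_word_def image_image case_prod_unfold)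

lemma FA_adj [simp]: "f \<in> FA G \<Longrightarrow> adj_free f \<in> FA G"
  by (induction f rule: FA_induct)
    (simp_all add: adj_free_single adj_free_add fst_letters_adj_word FA_single)

lemma FA_map_free: "f \<in> FA G \<Longrightarrow> r ` G \<subseteq> H \<Longrightarrow> map_free r f \<in> FA H"
proof (induction f rule: FA_induct)
  case (single w c)
  then show ?case
    unfolding map_free_single by (intro FA_single) (auto simp: fst_letters_map_word)
qed (simp_all add: map_free_add)

lemma star_hom_map_free:
  assumes "r ` G \<subseteq> H"
  shows "star_hom (free_star_algebra G) (free_star_algebra H) (map_free r)"
  using assms
  by (auto simp: star_hom_def ring_hom_def FA_map_free map_free_mult map_free_add map_free_adj
      map_free_single)

lemma ring_of_type_algebra_simps [simp]:
  "carrier ring_of_type_algebra = UNIV" "monoid.mult ring_of_type_algebra = (*)"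
  "one ring_of_type_algebra = 1" "ring.zero ring_of_type_algebra = 0"
  "add ring_of_type_algebra = (+)"
  by (simp_all add: ring_of_type_algebra_def fun_eq_iff)

lemma star_algebra_free: "star_algebra (free_star_algebra G)"
proof (intro star_algebra.intro module.intro)
  show *: "ring (free_star_algebra G)"
  proof (intro ringI abelian_groupI)
    fix f assume "f \<in> FA G"
    then show "\<exists>g\<in>FA G. g \<oplus>\<^bsub>free_star_algebra G\<^esub> f = \<zero>\<^bsub>free_star_algebra G\<^esub>"
      by (intro bexI[of _ "- f"]) simp_all
  qed (auto simp: algebra_simps intro!: monoidI)
  show "cring (ring_of_type_algebra :: complex ring)"
    by (rule cring_from_type_algebra)
  show "abelian_group (free_star_algebra G)"
    using * by (rule ring.is_abelian_group)
  show "module_axioms (ring_of_type_algebra :: complex ring) (free_star_algebra G)"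
    by unfold_locales (simp_all add: algebra_simps single_add sc_mult_assoc)
  show "star_algebra_axioms (free_star_algebra G)"
    by unfold_locales (simp_all add: algebra_simps adj_free_add adj_free_mult sc_left_commute sc_central)
qed

subsection \<open>Star homomorphisms and quotients\<close>

lemma star_homD:
  assumes "star_hom A B h"
  shows "x \<in> carrier A \<Longrightarrow> h x \<in> carrier B"
    and "x \<in> carrier A \<Longrightarrow> y \<in> carrier A \<Longrightarrow> h (x \<oplus>\<^bsub>A\<^esub> y) = h x \<oplus>\<^bsub>B\<^esub> h y"
    and "x \<in> carrier A \<Longrightarrow> y \<in> carrier A \<Longrightarrow> h (x \<otimes>\<^bsub>A\<^esub> y) = h x \<otimes>\<^bsub>B\<^esub> h y"
    and "h \<one>\<^bsub>A\<^esub> = \<one>\<^bsub>B\<^esub>"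
    and "x \<in> carrier A \<Longrightarrow> h (module.smult A c x) = module.smult B c (h x)"
    and "x \<in> carrier A \<Longrightarrow> h (adj A x) = adj B (h x)"
  using assms by (auto simp: star_hom_def ring_hom_def)

lemma star_homI:
  assumes "\<And>x. x \<in> carrier A \<Longrightarrow> h x \<in> carrier B"
    and "\<And>x y. x \<in> carrier A \<Longrightarrow> y \<in> carrier A \<Longrightarrow> h (x \<oplus>\<^bsub>A\<^esub> y) = h x \<oplus>\<^bsub>B\<^esub> h y"
    and "\<And>x y. x \<in> carrier A \<Longrightarrow> y \<in> carrier A \<Longrightarrow> h (x \<otimes>\<^bsub>A\<^esub> y) = h x \<otimes>\<^bsub>B\<^esub> h y"
    and "h \<one>\<^bsub>A\<^esub> = \<one>\<^bsub>B\<^esub>"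
    and "\<And>c x. x \<in> carrier A \<Longrightarrow> h (module.smult A c x) = module.smult B c (h x)"
    and "\<And>x. x \<in> carrier A \<Longrightarrow> h (adj A x) = adj B (h x)"
  shows "star_hom A B h"
  using assms by (simp add: star_hom_def ring_hom_memI)

lemma star_hom_zero:
  assumes A: "star_algebra A" and B: "star_algebra B" and h: "star_hom A B h"
  shows "h \<zero>\<^bsub>A\<^esub> = \<zero>\<^bsub>B\<^esub>"
proof -
  interpret A: ring A using A by (rule star_algebra.axioms)
  interpret A': star_algebra A by fact
  interpret B: ring B using B by (rule star_algebra.axioms)
  have "h \<zero>\<^bsub>A\<^esub> \<oplus>\<^bsub>B\<^esub> h \<zero>\<^bsub>A\<^esub> = h \<zero>\<^bsub>A\<^esub>"
    using star_homD(2)[OF assms(3), of "\<zero>\<^bsub>A\<^esub>" "\<zero>\<^bsub>A\<^esub>"] by simp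
  then show ?thesis
    using star_homD(1)[OF assms(3), of "\<zero>\<^bsub>A\<^esub>"] B.add.r_cancel_one by simp
qed

lemma star_hom_comp:
  "star_hom A B g \<Longrightarrow> star_hom B C h \<Longrightarrow> star_hom A C (h \<circ> g)"
  by (rule star_homI) (simp_all add: star_homD)

lemma star_hom_finsum:
  assumes A: "star_algebra A" and B: "star_algebra B" and h: "star_hom A B h"
    and "\<And>i. i \<in> I \<Longrightarrow> f i \<in> carrier A"
  shows "h (\<Oplus>\<^bsub>A\<^esub>i\<in>I. f i) = (\<Oplus>\<^bsub>B\<^esub>i\<in>I. h (f i))"
proof -
  interpret A: ring A using A by (rule star_algebra.axioms)
  interpret A': star_algebra A by fact
  interpret B: ring B using B by (rule star_algebra.axioms)
  note [simp] = star_hom_zero[OF assms(1-3)] star_homD[OF assms(3)]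
  show ?thesis
    using assms(4)
    by (induction I rule: infinite_finite_induct) (auto simp: Pi_def)
qed

lemma (in star_algebra) smult_mem [simp]: "x \<in> carrier A \<Longrightarrow> module.smult A c x \<in> carrier A"
  using smult_closed by simp

text \<open>The axioms are equations plus the existence of negatives, and these pass to a surjective
  image. Zero is a hypothesis of its own because \<open>star_hom_zero\<close> needs to know already
  that the target is an algebra.\<close>

lemma star_algebra_image:
  assumes A: "star_algebra A" and h: "star_hom A B h" and zero: "h \<zero>\<^bsub>A\<^esub> = \<zero>\<^bsub>B\<^esub>"
    and surj: "carrier B = h ` carrier A"
  shows "star_algebra B"
proof -
  interpret A: ring A using A by (rule star_algebra.axioms)
  interpret A': star_algebra A by fact
  note hom' = star_homD(2-6)[OF h, symmetric] zero[symmetric]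
  have ring: "ring B"
  proof (intro ringI abelian_groupI monoidI)
    fix x assume "x \<in> carrier B"
    then obtain a where "x = h a" "a \<in> carrier A" by (auto simp: surj)
    then show "\<exists>y\<in>carrier B. y \<oplus>\<^bsub>B\<^esub> x = \<zero>\<^bsub>B\<^esub>"
      by (intro bexI[of _ "h (\<ominus>\<^bsub>A\<^esub> a)"]) (simp_all add: hom' surj A.l_neg)
  qed (auto simp: surj hom' A.a_ac A.m_assoc A.l_distr A.r_distr)
  show ?thesis
  proof (intro star_algebra.intro module.intro)
    show "abelian_group B"
      using ring by (rule ring.is_abelian_group)
    show "module_axioms (ring_of_type_algebra :: complex ring) B"
      using A'.smult_l_distr A'.smult_r_distr A'.smult_assoc1 A'.smult_one
      by unfold_locales (auto simp: surj hom')
    show "star_algebra_axioms B"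
      using A'.smult_mult_left A'.smult_mult_right A'.adj_closed A'.adj_adj A'.adj_add A'.adj_mult
        A'.adj_smult
      by unfold_locales (auto simp: surj hom')
  qed (use ring cring_from_type_algebra in auto)
qed

lemma star_quot_hom:
  assumes A: "star_algebra A" and J: "ideal J A" and adjJ: "\<And>x. x \<in> J \<Longrightarrow> adj A x \<in> J"
  shows "star_hom A (star_quot A J) (\<lambda>x. J +>\<^bsub>A\<^esub> x)"
    and "star_algebra (star_quot A J)"
    and "carrier (star_quot A J) = (\<lambda>x. J +>\<^bsub>A\<^esub> x) ` carrier A"
proof -
  interpret A: ring A using A by (rule star_algebra.axioms)
  interpret A': star_algebra A by fact
  interpret J: ideal J A by fact
  have smult: "module.smult (star_quot A J) c (J +>\<^bsub>A\<^esub> x) = J +>\<^bsub>A\<^esub> module.smult A c x"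
    if x: "x \<in> carrier A" for c x
  proof -
    have "J +>\<^bsub>A\<^esub> module.smult A c y = J +>\<^bsub>A\<^esub> module.smult A c x" if y: "y \<in> J +>\<^bsub>A\<^esub> x" for y
    proof -
      obtain j where j: "j \<in> J" "y = j \<oplus>\<^bsub>A\<^esub> x"
        using y by (auto simp: a_r_coset_def')
      \<comment> \<open>Ideals are closed under ring multiplication only; closure under scalars
        follows by writing the scalar as a multiple of the unit.\<close>
      have "module.smult A c j = module.smult A c \<one>\<^bsub>A\<^esub> \<otimes>\<^bsub>A\<^esub> j"
        using j(1) J.a_Hcarr by (simp add: A'.smult_mult_left)
      then have "module.smult A c j \<in> J"
        using j(1) J.I_l_closed by simp
      then have "module.smult A c y \<in> J +>\<^bsub>A\<^esub> module.smult A c x"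
        using j x J.a_Hcarr by (auto simp: a_r_coset_def' A'.smult_r_distr)
      then show ?thesis
        using J.a_repr_independence'[OF _ A'.smult_mem[OF x]] by simp
    qed
    \<comment> \<open>The quotient operation is a union over all representatives. Each member of the
      union is the same coset, so the union is that coset.\<close>
    then have "(\<Union>y\<in>J +>\<^bsub>A\<^esub> x. J +>\<^bsub>A\<^esub> module.smult A c y) = J +>\<^bsub>A\<^esub> module.smult A c x"
      by (intro UN_constant_eq[OF J.a_rcos_self[OF x]] ballI)
    then show ?thesis
      unfolding star_quot_def by simp
  qed
  have adj: "adj (star_quot A J) (J +>\<^bsub>A\<^esub> x) = J +>\<^bsub>A\<^esub> adj A x"
    if x: "x \<in> carrier A" for x
  proof -
    have "J +>\<^bsub>A\<^esub> adj A y = J +>\<^bsub>A\<^esub> adj A x" if y: "y \<in> J +>\<^bsub>A\<^esub> x" for y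
    proof -
      obtain j where j: "j \<in> J" "y = j \<oplus>\<^bsub>A\<^esub> x"
        using y by (auto simp: a_r_coset_def')
      then have "adj A y \<in> J +>\<^bsub>A\<^esub> adj A x"
        using j x J.a_Hcarr adjJ by (auto simp: a_r_coset_def' A'.adj_add)
      then show ?thesis
        using J.a_repr_independence'[OF _ A'.adj_closed[OF x]] by simp
    qed
    then have "(\<Union>y\<in>J +>\<^bsub>A\<^esub> x. J +>\<^bsub>A\<^esub> adj A y) = J +>\<^bsub>A\<^esub> adj A x"
      by (intro UN_constant_eq[OF J.a_rcos_self[OF x]] ballI)
    then show ?thesis
      unfolding star_quot_def by simp
  qed
  show carr: "carrier (star_quot A J) = (\<lambda>x. J +>\<^bsub>A\<^esub> x) ` carrier A"
    by (auto simp: star_quot_def FactRing_simps)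
  show hom: "star_hom A (star_quot A J) (\<lambda>x. J +>\<^bsub>A\<^esub> x)"
    using smult adj
    by (auto simp: star_hom_def ring_hom_def carr)
      (auto simp: star_quot_def FactRing_simps J.rcoset_mult_add J.a_rcos_sum)
  show "star_algebra (star_quot A J)"
  proof (rule star_algebra_image[OF A hom _ carr])
    show "J +>\<^bsub>A\<^esub> \<zero>\<^bsub>A\<^esub> = \<zero>\<^bsub>star_quot A J\<^esub>"
      using A.a_rcos_zero[OF J] J.zero_closed by (simp add: star_quot_def FactRing_simps)
  qed
qed

lemma star_ideal:
  assumes A: "star_algebra A" and R: "R \<subseteq> carrier A"
  shows "ideal (star_ideal A R) A" "R \<subseteq> star_ideal A R"
    and "\<And>x. x \<in> star_ideal A R \<Longrightarrow> adj A x \<in> star_ideal A R"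
proof -
  interpret A: ring A using A by (rule star_algebra.axioms)
  interpret A': star_algebra A by fact
  let ?S = "{I. ideal I A \<and> R \<subseteq> I \<and> (\<forall>x\<in>I. adj A x \<in> I)}"
  \<comment> \<open>An intersection of ideals is an ideal only if the family is nonempty; the whole
    algebra is a member.\<close>
  have "carrier A \<in> ?S"
    using A.oneideal A'.adj_closed R by auto
  then show "ideal (star_ideal A R) A"
    unfolding star_ideal_def by (intro A.i_Intersect) auto
qed (auto simp: star_ideal_def)

lemma star_hom_kernel:
  assumes A: "star_algebra A" and B: "star_algebra B" and h: "star_hom A B h"
  shows "ideal {x \<in> carrier A. h x = \<zero>\<^bsub>B\<^esub>} A"
    and "\<And>x. x \<in> carrier A \<Longrightarrow> h x = \<zero>\<^bsub>B\<^esub> \<Longrightarrow> h (adj A x) = \<zero>\<^bsub>B\<^esub>"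
proof -
  interpret A: ring A using A by (rule star_algebra.axioms)
  interpret A': star_algebra A by fact
  interpret B: ring B using B by (rule star_algebra.axioms)
  have "h \<in> ring_hom A B"
    using h by (simp add: star_hom_def)
  then interpret h: ring_hom_ring A B h
    by (rule ring_hom_ringI2[OF A.ring_axioms B.ring_axioms])
  show "ideal {x \<in> carrier A. h x = \<zero>\<^bsub>B\<^esub>} A"
    using h.kernel_is_ideal unfolding a_kernel_def' .
  have "adj B \<zero>\<^bsub>B\<^esub> \<oplus>\<^bsub>B\<^esub> adj B \<zero>\<^bsub>B\<^esub> = adj B \<zero>\<^bsub>B\<^esub>"
    using star_algebra.adj_add[OF B B.zero_closed B.zero_closed] by simp
  then have "adj B \<zero>\<^bsub>B\<^esub> = \<zero>\<^bsub>B\<^esub>"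
    using star_algebra.adj_closed[OF B B.zero_closed] B.add.r_cancel_one by simp
  then show "x \<in> carrier A \<Longrightarrow> h x = \<zero>\<^bsub>B\<^esub> \<Longrightarrow> h (adj A x) = \<zero>\<^bsub>B\<^esub>" for x
    by (simp add: star_homD(6)[OF h])
qed

text \<open>Universal property of the quotient: the kernel of \<open>h\<close> is a star-closed
  ideal containing \<open>R\<close>, hence one of the sets intersected in \<open>star_ideal\<close>,
  and so \<open>h\<close> is constant on cosets.\<close>

lemma star_quot_lift:
  assumes A: "star_algebra A" and B: "star_algebra B" and h: "star_hom A B h"
    and R: "R \<subseteq> carrier A" and zero: "\<And>r. r \<in> R \<Longrightarrow> h r = \<zero>\<^bsub>B\<^esub>"
  obtains \<alpha> where "star_hom (star_quot A (star_ideal A R)) B \<alpha>"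
    and "\<And>x. x \<in> carrier A \<Longrightarrow> \<alpha> (star_ideal A R +>\<^bsub>A\<^esub> x) = h x"
proof -
  interpret A: ring A using A by (rule star_algebra.axioms)
  interpret A': star_algebra A by fact
  interpret B: ring B using B by (rule star_algebra.axioms)
  let ?J = "star_ideal A R"
  note J = star_ideal[OF A R]
  interpret J: ideal ?J A by (rule J)
  note q = star_quot_hom[OF A J(1,3), simplified]
  have ker: "h x = \<zero>\<^bsub>B\<^esub>" if "x \<in> ?J" for x
  proof -
    have "{x \<in> carrier A. h x = \<zero>\<^bsub>B\<^esub>} \<in> {I. ideal I A \<and> R \<subseteq> I \<and> (\<forall>x\<in>I. adj A x \<in> I)}"
      using star_hom_kernel[OF A B h] R zero A'.adj_closed by auto
    then show ?thesis
      using that unfolding star_ideal_def by blast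
  qed
  have const: "h y = h x" if x: "x \<in> carrier A" and y: "y \<in> ?J +>\<^bsub>A\<^esub> x" for x y
  proof -
    obtain j where "j \<in> ?J" "y = j \<oplus>\<^bsub>A\<^esub> x"
      using y by (auto simp: a_r_coset_def')
    then show ?thesis
      using ker J.a_Hcarr x star_homD(1,2)[OF h] by simp
  qed
  \<comment> \<open>The value is read off an arbitrary representative; \<open>const\<close> makes
    the choice harmless.\<close>
  define \<alpha> where "\<alpha> Y = h (SOME y. y \<in> Y)" for Y
  have \<alpha>: "\<alpha> (?J +>\<^bsub>A\<^esub> x) = h x" if "x \<in> carrier A" for x
    unfolding \<alpha>_def using const[OF that] J.a_rcos_self[OF that] by (metis someI)
  have "star_hom (star_quot A ?J) B \<alpha>"
    using \<alpha> star_homD[OF h]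
    by (intro star_homI)
      (auto simp: q(3) A'.adj_closed star_homD(2-6)[OF q(1), symmetric])
  then show ?thesis
    using \<alpha> that by blast
qed

lemma presented:
  assumes "R \<subseteq> FA G"
  shows "star_algebra (presented G R)"
    and "star_hom (free_star_algebra G) (presented G R)
      (\<lambda>f. star_ideal (free_star_algebra G) R +>\<^bsub>free_star_algebra G\<^esub> f)"
    and "r \<in> R \<Longrightarrow> star_ideal (free_star_algebra G) R +>\<^bsub>free_star_algebra G\<^esub> r = \<zero>\<^bsub>presented G R\<^esub>"
    and "carrier (presented G R) =
      (\<lambda>f. star_ideal (free_star_algebra G) R +>\<^bsub>free_star_algebra G\<^esub> f) ` FA G"
proof -
  note A = star_algebra_free[of G]
  interpret A: ring "free_star_algebra G" using A by (rule star_algebra.axioms)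
  note J = star_ideal[OF A assms]
  note q = star_quot_hom[OF A J(1,3), simplified]
  show "star_algebra (presented G R)"
    "star_hom (free_star_algebra G) (presented G R)
      (\<lambda>f. star_ideal (free_star_algebra G) R +>\<^bsub>free_star_algebra G\<^esub> f)"
    "carrier (presented G R) =
      (\<lambda>f. star_ideal (free_star_algebra G) R +>\<^bsub>free_star_algebra G\<^esub> f) ` FA G"
    unfolding presented_def using q by auto
  show "star_ideal (free_star_algebra G) R +>\<^bsub>free_star_algebra G\<^esub> r = \<zero>\<^bsub>presented G R\<^esub>" if "r \<in> R"
    unfolding presented_def using A.a_rcos_zero[OF J(1), of r] J(2) that
    by (auto simp: star_quot_def FactRing_simps)
qed

subsection \<open>Congruence modulo the kernel of a star homomorphism\<close>

text \<open>Common setting for the group algebras and both free products: elements of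
  \<open>B\<close> are handled through preimages under \<open>q\<close> in a free algebra.\<close>

locale free_image =
  fixes G :: "'g set" and B :: "('b, 'm) star_algebra_scheme" and q :: "'g free \<Rightarrow> 'b"
  assumes star_algebra_B: "star_algebra B"
    and hom_q: "star_hom (free_star_algebra G) B q"
begin

sublocale B: ring B
  using star_algebra_B by (rule star_algebra.axioms)

sublocale B': star_algebra B
  by (rule star_algebra_B)

lemmas q_hom = star_homD[OF hom_q, simplified]

lemma q_0: "q 0 = \<zero>\<^bsub>B\<^esub>"
  using star_hom_zero[OF star_algebra_free star_algebra_B hom_q] by simp

lemma q_uminus: "f \<in> FA G \<Longrightarrow> q (- f) = \<ominus>\<^bsub>B\<^esub> q f"
  using q_hom(2)[of "- f" f] B.minus_equality[of "q (- f)" "q f"] by (simp add: q_0 q_hom(1))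

lemma q_diff: "f \<in> FA G \<Longrightarrow> g \<in> FA G \<Longrightarrow> q (f - g) = q f \<ominus>\<^bsub>B\<^esub> q g"
  using q_hom(2)[of f "- g"] by (simp add: q_uminus a_minus_def)

lemma q_sum: "(\<And>i. i \<in> I \<Longrightarrow> h i \<in> FA G) \<Longrightarrow> q (\<Sum>i\<in>I. h i) = (\<Oplus>\<^bsub>B\<^esub>i\<in>I. q (h i))"
  by (induction I rule: infinite_finite_induct)
    (auto simp: q_0 q_hom B.finsum_insert Pi_def)

lemma q_power: "f \<in> FA G \<Longrightarrow> q (f ^ n) = q f [^]\<^bsub>B\<^esub> n"
  by (induction n) (simp_all add: q_hom power_Suc2 del: power_Suc)

text \<open>Membership of both sides is built in, since \<open>q\<close> is controlled only on
  \<open>FA G\<close>; chains of congruences then carry their own side conditions.\<close>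

definition eqv :: "'g free \<Rightarrow> 'g free \<Rightarrow> bool" (infix \<open>\<doteq>\<close> 50) where
  "f \<doteq> g \<longleftrightarrow> f \<in> FA G \<and> g \<in> FA G \<and> q f = q g"

lemma eqvD: "f \<doteq> g \<Longrightarrow> f \<in> FA G" "f \<doteq> g \<Longrightarrow> g \<in> FA G" "f \<doteq> g \<Longrightarrow> q f = q g"
  by (simp_all add: eqv_def)

lemma eqv_refl: "f \<in> FA G \<Longrightarrow> f \<doteq> f"
  by (simp add: eqv_def)

lemma eqv_sym: "f \<doteq> g \<Longrightarrow> g \<doteq> f"
  by (simp add: eqv_def)

lemma eqv_trans [trans]: "f \<doteq> g \<Longrightarrow> g \<doteq> h \<Longrightarrow> f \<doteq> h"
  by (simp add: eqv_def)

lemma eqv_add: "f \<doteq> f' \<Longrightarrow> g \<doteq> g' \<Longrightarrow> f + g \<doteq> f' + g'"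
  by (simp add: eqv_def q_hom)

lemma eqv_diff: "f \<doteq> f' \<Longrightarrow> g \<doteq> g' \<Longrightarrow> f - g \<doteq> f' - g'"
  by (simp add: eqv_def q_diff)

lemma eqv_mult: "f \<doteq> f' \<Longrightarrow> g \<doteq> g' \<Longrightarrow> f * g \<doteq> f' * g'"
  by (simp add: eqv_def q_hom)

lemma eqv_mult_left: "f \<in> FA G \<Longrightarrow> g \<doteq> g' \<Longrightarrow> f * g \<doteq> f * g'"
  by (simp add: eqv_def q_hom)

lemma eqv_mult_right: "g \<in> FA G \<Longrightarrow> f \<doteq> f' \<Longrightarrow> f * g \<doteq> f' * g"
  by (simp add: eqv_def q_hom)

lemma eqv_sc: "f \<doteq> f' \<Longrightarrow> sc c * f \<doteq> sc c * f'"
  by (rule eqv_mult) (simp_all add: eqv_refl)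

lemma eqv_adj: "f \<doteq> f' \<Longrightarrow> adj_free f \<doteq> adj_free f'"
  by (simp add: eqv_def q_hom)

lemma eqv_sum: "(\<And>i. i \<in> I \<Longrightarrow> f i \<doteq> g i) \<Longrightarrow> (\<Sum>i\<in>I. f i) \<doteq> (\<Sum>i\<in>I. g i)"
  by (induction I rule: infinite_finite_induct) (simp_all add: eqv_add eqv_refl)

end

subsection \<open>Spectral projections\<close>

lemma root_of_unity_powers:
  assumes "0 < k"
  shows "root_of_unity k ^ k = 1" "root_of_unity k \<noteq> 0" "cnj (root_of_unity k) = inverse (root_of_unity k)"
    and "a < k \<Longrightarrow> b < k \<Longrightarrow> root_of_unity k ^ a = root_of_unity k ^ b \<longleftrightarrow> a = b"
proof -
  have pow: "root_of_unity k ^ n = exp (2 * of_real pi * \<i> * of_nat n / of_nat k)" for n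
    by (simp add: root_of_unity_def mult_ac flip: exp_of_nat_mult)
  show "root_of_unity k ^ k = 1"
    using assms by (simp add: pow)
  show "root_of_unity k \<noteq> 0" "cnj (root_of_unity k) = inverse (root_of_unity k)"
    by (simp_all add: root_of_unity_def exp_cnj flip: exp_minus)
  show "a < k \<Longrightarrow> b < k \<Longrightarrow> root_of_unity k ^ a = root_of_unity k ^ b \<longleftrightarrow> a = b"
    using complex_root_unity_eq[of k a b] assms by (simp add: pow)
qed

text \<open>Orthogonality of the characters of the cyclic group: the base is a k-th root of unity,
  it equals 1 exactly when a = b, and otherwise the geometric sum vanishes.\<close>

lemma root_of_unity_sum:
  assumes "a < k" "b < k"
  shows "(\<Sum>n<k. (root_of_unity k ^ a * inverse (root_of_unity k) ^ b) ^ n) = (if a = b then of_nat k else 0)"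
proof -
  note r = root_of_unity_powers[of k]
  let ?y = "root_of_unity k ^ a * inverse (root_of_unity k) ^ b"
  have y1: "?y = 1 \<longleftrightarrow> a = b"
    using r assms by (simp add: field_simps power_inverse)
  have "?y ^ k = 1"
    using r(1) assms by (simp add: power_mult_distrib power_inverse flip: power_mult)
      (simp add: mult.commute[of _ k] power_mult)
  then show ?thesis
    using geometric_sum[of ?y k] y1 by auto
qed

text \<open>Representative of \<open>spectral_proj\<close>. The negative exponents become natural
  powers of the inverse root, so that geometric sums apply.\<close>

definition spectral :: "nat \<Rightarrow> nat \<Rightarrow> 'g free \<Rightarrow> 'g free" where
  "spectral k a f = sc (1 / of_nat k) * (\<Sum>n<k. sc ((inverse (root_of_unity k) ^ a) ^ n) * f ^ n)"

lemma FA_spectral [simp]: "f \<in> FA G \<Longrightarrow> spectral k a f \<in> FA G"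
  by (simp add: spectral_def)

text \<open>An exact identity in the free algebra: summing over \<open>a\<close> first annihilates
  every power of \<open>f\<close> except the zeroth.\<close>

lemma sum_spectral:
  assumes "0 < k"
  shows "(\<Sum>a<k. spectral k a f) = 1"
proof -
  let ?w = "inverse (root_of_unity k)"
  have *: "(\<Sum>a<k. (?w ^ a) ^ n) = (if n = 0 then of_nat k else 0)" if "n < k" for n
    using root_of_unity_sum[of 0 k n] that assms
    by (simp add: mult.commute flip: power_mult)
  have "(\<Sum>a<k. spectral k a f) = sc (1 / of_nat k) * (\<Sum>n<k. sc (\<Sum>a<k. (?w ^ a) ^ n) * f ^ n)"
    unfolding spectral_def sum_distrib_left[symmetric] sc_sum sum_distrib_right
    by (subst sum.swap) simp
  also have "(\<Sum>n<k. sc (\<Sum>a<k. (?w ^ a) ^ n) * f ^ n) = (\<Sum>n<k. if n = 0 then sc (of_nat k) else 0)"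
    by (rule sum.cong) (auto simp: *)
  also have "\<dots> = sc (of_nat k)"
    using assms by simp
  finally have "(\<Sum>a<k. spectral k a f) = sc (1 / of_nat k * of_nat k)"
    by (simp only: sc_mult)
  then show ?thesis
    using assms by simp
qed

context free_image
begin

lemma spectral_proj_eq:
  assumes "f \<in> FA G"
  shows "spectral_proj k B a (q f) = q (spectral k a f)"
proof -
  have "root_of_unity k powi (- int (n * a)) = (inverse (root_of_unity k) ^ a) ^ n" for n
    by (simp add: power_int_minus power_inverse mult.commute flip: power_mult del: of_nat_mult)
  then show ?thesis
    using assms
    by (simp add: spectral_proj_def spectral_def q_hom(5) q_sum q_power lessThan_atLeast0)
qed

text \<open>\<open>p\<close> acts as an eigenvector of left multiplication by \<open>g\<close>, with
  eigenvalue \<open>c\<close>.\<close>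

lemma power_mult_eigen:
  assumes "g \<in> FA G" "p \<in> FA G" "g * p \<doteq> sc c * p"
  shows "g ^ n * p \<doteq> sc (c ^ n) * p"
proof (induction n)
  case 0
  then show ?case using assms(2) by (simp add: eqv_refl)
next
  case (Suc n)
  have "g ^ Suc n * p = g * (g ^ n * p)"
    by (simp add: mult.assoc)
  also have "\<dots> \<doteq> g * (sc (c ^ n) * p)"
    using assms(1) Suc by (rule eqv_mult_left)
  also have "\<dots> = sc (c ^ n) * (g * p)"
    by (rule sc_left_commute)
  also have "\<dots> \<doteq> sc (c ^ n) * (sc c * p)"
    using assms(3) by (rule eqv_sc)
  also have "\<dots> = sc (c ^ Suc n) * p"
    by (simp add: sc_mult_assoc mult.commute)
  finally show ?case .
qed

context
  fixes f :: "'g free" and k :: nat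
  assumes f: "f \<in> FA G" and unitary: "adj_free f * f \<doteq> 1" and order: "f ^ k \<doteq> 1"
    and k: "0 < k"
begin

text \<open>Multiplication by \<open>f\<close> shifts the summation index by one. The shifted sum
  differs from the original only in its end terms, for n = k and n = 0, and these agree because both
  \<open>f\<close> and the root have k-th power 1.\<close>

lemma mult_spectral: "f * spectral k a f \<doteq> sc (root_of_unity k ^ a) * spectral k a f"
proof -
  note r = root_of_unity_powers[OF k]
  let ?w = "root_of_unity k"
  let ?g = "\<lambda>n. sc ((inverse ?w ^ a) ^ n) * f ^ n"
  have "(inverse ?w ^ a) ^ k = 1"
    using r(1) by (metis inverse_1 mult.commute power_inverse power_mult power_one)
  then have gk: "?g k \<doteq> ?g 0"
    using order by simp
  have 1: "f * ?g n = sc (?w ^ a) * ?g (Suc n)" for n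
  proof -
    have "?w ^ a * (inverse ?w ^ a) ^ Suc n = (inverse ?w ^ a) ^ n"
      using r(2) by (simp add: power_inverse)
    then show ?thesis
      by (simp only: sc_left_commute[of f] sc_mult_assoc power_Suc[of f])
  qed
  have shift: "(\<Sum>n<k. h (Suc n)) = (\<Sum>n<k. h n) + h k - h 0" for h :: "nat \<Rightarrow> 'g free"
    by (induction k) simp_all
  have "(\<Sum>n<k. ?g (Suc n)) = (\<Sum>n<k. ?g n) + ?g k - ?g 0"
    by (rule shift[of ?g])
  also have "\<dots> \<doteq> (\<Sum>n<k. ?g n) + ?g 0 - ?g 0"
    using f by (intro eqv_add eqv_diff gk eqv_refl) simp_all
  finally have "(\<Sum>n<k. ?g (Suc n)) \<doteq> (\<Sum>n<k. ?g n)"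
    by simp
  then have "sc (1 / of_nat k) * (sc (?w ^ a) * (\<Sum>n<k. ?g (Suc n))) \<doteq>
      sc (1 / of_nat k) * (sc (?w ^ a) * (\<Sum>n<k. ?g n))"
    by (intro eqv_sc)
  moreover have "f * spectral k a f = sc (1 / of_nat k) * (sc (?w ^ a) * (\<Sum>n<k. ?g (Suc n)))"
  proof -
    have "f * (\<Sum>n<k. ?g n) = sc (?w ^ a) * (\<Sum>n<k. ?g (Suc n))"
      unfolding sum_distrib_left 1 ..
    then show ?thesis
      unfolding spectral_def sc_left_commute[of f "1 / of_nat k"] by simp
  qed
  moreover have "sc (?w ^ a) * spectral k a f = sc (1 / of_nat k) * (sc (?w ^ a) * (\<Sum>n<k. ?g n))"
    unfolding spectral_def sc_mult_assoc by (simp add: mult.commute)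
  ultimately show ?thesis
    by simp
qed

text \<open>The adjoint is a left inverse of \<open>f\<close>, so it has the inverse
  eigenvalue.\<close>

lemma adj_mult_spectral:
  "adj_free f * spectral k a f \<doteq> sc (inverse (root_of_unity k) ^ a) * spectral k a f"
proof -
  note r = root_of_unity_powers[OF k]
  let ?w = "root_of_unity k"
  let ?P = "spectral k a f"
  have "sc (inverse ?w ^ a) * ?P = sc (inverse ?w ^ a) * (1 * ?P)"
    by simp
  also have "\<dots> \<doteq> sc (inverse ?w ^ a) * ((adj_free f * f) * ?P)"
    using f by (intro eqv_sc eqv_mult_right eqv_sym[OF unitary]) simp
  also have "\<dots> = sc (inverse ?w ^ a) * (adj_free f * (f * ?P))"
    by (simp add: mult.assoc)
  also have "\<dots> \<doteq> sc (inverse ?w ^ a) * (adj_free f * (sc (?w ^ a) * ?P))"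
    using f by (intro eqv_sc eqv_mult_left mult_spectral) simp
  also have "\<dots> = adj_free f * ?P"
    using r(2) by (simp add: sc_left_commute[of "adj_free f"] sc_mult_assoc power_inverse)
  finally show ?thesis
    by (rule eqv_sym)
qed

text \<open>Stated for any \<open>g\<close> with the eigenvector property in order to serve twice:
  with \<open>g = f\<close> for products of spectral projections, and with
  \<open>g = adj_free f\<close> for self-adjointness.\<close>

lemma spectral_sum_mult:
  assumes g: "g \<in> FA G" and eigen: "g * spectral k a f \<doteq> sc c * spectral k a f"
  shows "(sc (1 / of_nat k) * (\<Sum>n<k. sc (d ^ n) * g ^ n)) * spectral k a f \<doteq>
    sc ((\<Sum>n<k. (c * d) ^ n) / of_nat k) * spectral k a f"
proof -
  let ?P = "spectral k a f"
  have "(sc (1 / of_nat k) * (\<Sum>n<k. sc (d ^ n) * g ^ n)) * ?P =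
      sc (1 / of_nat k) * (\<Sum>n<k. sc (d ^ n) * (g ^ n * ?P))"
    by (simp add: mult.assoc sum_distrib_right)
  also have "\<dots> \<doteq> sc (1 / of_nat k) * (\<Sum>n<k. sc (d ^ n) * (sc (c ^ n) * ?P))"
    using f by (intro eqv_sc eqv_sum power_mult_eigen g eigen) simp
  also have "\<dots> = sc (1 / of_nat k) * (sc (\<Sum>n<k. (c * d) ^ n) * ?P)"
    by (simp add: sc_mult_assoc sc_sum sum_distrib_right power_mult_distrib mult.commute)
  also have "\<dots> = sc ((\<Sum>n<k. (c * d) ^ n) / of_nat k) * ?P"
    by (simp add: sc_mult_assoc)
  finally show ?thesis .
qed

lemma spectral_mult:
  assumes "a < k" "b < k"
  shows "spectral k b f * spectral k a f \<doteq> (if a = b then spectral k a f else 0)"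
proof -
  have "spectral k b f * spectral k a f \<doteq>
      sc ((\<Sum>n<k. (root_of_unity k ^ a * inverse (root_of_unity k) ^ b) ^ n) / of_nat k) * spectral k a f"
    unfolding spectral_def[of k b] by (rule spectral_sum_mult[OF f mult_spectral])
  then show ?thesis
    unfolding root_of_unity_sum[OF assms] using k by (simp split: if_splits)
qed

text \<open>With P the projection, the eigenvalue computation gives P* P = P, and P* P is
  self-adjoint.\<close>

lemma spectral_adj:
  assumes "a < k"
  shows "adj_free (spectral k a f) \<doteq> spectral k a f"
proof -
  let ?P = "spectral k a f"
  have "adj_free ?P * ?P =
      (sc (1 / of_nat k) * (\<Sum>n<k. sc ((root_of_unity k ^ a) ^ n) * adj_free f ^ n)) * ?P"
    using root_of_unity_powers(3)[OF k]
    by (simp add: spectral_def adj_free_scale adj_free_sum adj_free_power)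
  also have "\<dots> \<doteq> sc ((\<Sum>n<k. (inverse (root_of_unity k) ^ a * root_of_unity k ^ a) ^ n) / of_nat k) * ?P"
    by (rule spectral_sum_mult[OF FA_adj[OF f] adj_mult_spectral])
  also have "\<dots> = ?P"
    unfolding mult.commute[of "inverse (root_of_unity k) ^ a"] root_of_unity_sum[OF assms assms]
    using k by simp
  finally have *: "adj_free ?P * ?P \<doteq> ?P" .
  have "adj_free ?P \<doteq> adj_free (adj_free ?P * ?P)"
    by (rule eqv_sym[OF eqv_adj[OF *]])
  also have "\<dots> = adj_free ?P * ?P"
    by (simp add: adj_free_mult)
  also note *
  finally show ?thesis .
qed

end

end

subsection \<open>Presented algebras\<close>

abbreviation proj :: "'g set \<Rightarrow> 'g free set \<Rightarrow> 'g free \<Rightarrow> 'g free set" where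
  "proj G R f \<equiv> star_ideal (free_star_algebra G) R +>\<^bsub>free_star_algebra G\<^esub> f"

lemma free_image_presented: "R \<subseteq> FA G \<Longrightarrow> free_image G (presented G R) (proj G R)"
  by (simp add: free_image_def presented)

lemma presented_eqv:
  assumes "R \<subseteq> FA G" "f - g \<in> R" "f \<in> FA G" "g \<in> FA G"
  shows "free_image.eqv G (proj G R) f g"
proof -
  interpret free_image G "presented G R" "proj G R"
    using assms(1) by (rule free_image_presented)
  have "q' f = q' g" if "q' = proj G R" for q'
    using presented(3)[OF assms(1,2)] assms(3,4) q_diff[of f g] q_hom(1) that
    by (metis B.r_right_minus_eq)
  then show ?thesis
    using assms(3,4) by (simp add: eqv_def)
qed

text \<open>A word is a product of letters, so scalars, generators and their adjoints generate the
  algebra. Commutation can thus be checked on letters.\<close>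

lemma FA_algebra_induct [consumes 1, case_names sc gen adj_gen add mult]:
  assumes "f \<in> FA G"
    and sc: "\<And>c. P (sc c)"
    and gen: "\<And>g. g \<in> G \<Longrightarrow> P (gen g)" "\<And>g. g \<in> G \<Longrightarrow> P (adj_free (gen g))"
    and add: "\<And>f g. f \<in> FA G \<Longrightarrow> g \<in> FA G \<Longrightarrow> P f \<Longrightarrow> P g \<Longrightarrow> P (f + g)"
    and mult: "\<And>f g. f \<in> FA G \<Longrightarrow> g \<in> FA G \<Longrightarrow> P f \<Longrightarrow> P g \<Longrightarrow> P (f * g)"
  shows "P f"
proof -
  have word: "P (Poly_Mapping.single (Word l) c)" if "fst ` set l \<subseteq> G" for l c
    using that
  proof (induction l)
    case Nil
    then show ?case using sc[of c] by (simp add: zero_word_def)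
  next
    case (Cons p l)
    obtain g s where p: "p = (g, s)" by (cases p)
    then have g: "g \<in> G" using Cons.prems by simp
    have "Poly_Mapping.single (Word [(g, s)]) 1 = (if s then adj_free (gen g) else gen g)"
      by (simp add: gen_def adj_free_single adj_word_def)
    then have "P (Poly_Mapping.single (Word [(g, s)]) 1)"
      using gen[OF g] by simp
    moreover have "Poly_Mapping.single (Word (p # l)) c =
        Poly_Mapping.single (Word [(g, s)]) 1 * Poly_Mapping.single (Word l) c"
      by (simp add: mult_single plus_word_def p)
    moreover have "Poly_Mapping.single (Word [(g, s)]) 1 \<in> FA G" "Poly_Mapping.single (Word l) c \<in> FA G"
      using Cons.prems g by (auto intro!: FA_single simp: image_subset_iff)
    ultimately show ?case
      using Cons mult by simp
  qed
  show ?thesis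
    using assms(1)
  proof (induction rule: FA_induct)
    case (single w c)
    then show ?case using word[of "letters w" c] by (cases w) simp
  next
    case zero
    then show ?case using sc[of 0] by simp
  qed (rule add)
qed

section \<open>Commutation propagates from generators to the whole algebra\<close>

context free_image
begin

text \<open>The adjoint is the inverse of \<open>h\<close>: insert \<open>adj_free h * h\<close> on
  the left, commute, and cancel on the right.\<close>

lemma commute_adj_unitary:
  assumes "f \<in> FA G" "h \<in> FA G" "f * h \<doteq> h * f"
    and "adj_free h * h \<doteq> 1" "h * adj_free h \<doteq> 1"
  shows "f * adj_free h \<doteq> adj_free h * f"
proof -
  have "f * adj_free h = 1 * (f * adj_free h)"
    by simp
  also have "\<dots> \<doteq> (adj_free h * h) * (f * adj_free h)"
    using assms by (intro eqv_mult_right eqv_sym[OF assms(4)]) simp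
  also have "\<dots> = adj_free h * ((h * f) * adj_free h)"
    by (simp add: mult.assoc)
  also have "\<dots> \<doteq> adj_free h * ((f * h) * adj_free h)"
    using assms(1,2) by (intro eqv_mult_left eqv_mult_right eqv_sym[OF assms(3)]) simp_all
  also have "\<dots> = (adj_free h * f) * (h * adj_free h)"
    by (simp add: mult.assoc)
  also have "\<dots> \<doteq> (adj_free h * f) * 1"
    using assms(1,2) by (intro eqv_mult_left assms(5)) simp
  finally show ?thesis
    by simp
qed

lemma commute_induct:
  assumes "f \<in> FA G" "h \<in> FA G"
    and gen: "\<And>x. x \<in> G \<Longrightarrow> gen x * h \<doteq> h * gen x"
      "\<And>x. x \<in> G \<Longrightarrow> adj_free (gen x) * h \<doteq> h * adj_free (gen x)"
  shows "f * h \<doteq> h * f"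
  using assms(1)
proof (induction rule: FA_algebra_induct)
  case (sc c)
  then show ?case
    using assms(2) sc_central[of c h] by (simp add: eqv_refl)
next
  case (add f g)
  then show ?case
    by (simp add: distrib_left distrib_right eqv_add)
next
  case (mult f g)
  have "f * g * h = f * (g * h)"
    by (rule mult.assoc)
  also have "\<dots> \<doteq> f * (h * g)"
    using mult by (intro eqv_mult_left)
  also have "\<dots> = f * h * g"
    by (rule mult.assoc[symmetric])
  also have "\<dots> \<doteq> h * f * g"
    using mult by (intro eqv_mult_right)
  finally show ?case
    by (simp add: mult.assoc)
qed (rule gen, assumption)+

text \<open>The centralizer of an element is a subalgebra. This is applied twice, first to reduce
  \<open>f\<close> to a letter, then to reduce \<open>h\<close> to a letter for each fixed letter on
  the other side.\<close>

lemma commute_generators: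
  assumes comm: "\<And>x y. x \<in> G \<Longrightarrow> y \<in> G \<Longrightarrow> gen x * gen y \<doteq> gen y * gen x"
    and unitary: "\<And>x. x \<in> G \<Longrightarrow> adj_free (gen x) * gen x \<doteq> 1"
      "\<And>x. x \<in> G \<Longrightarrow> gen x * adj_free (gen x) \<doteq> 1"
    and "f \<in> FA G" "h \<in> FA G"
  shows "f * h \<doteq> h * f"
proof (rule commute_induct[OF assms(4,5)])
  note G = FA_gen FA_adj[OF FA_gen]
  have comm': "gen x * adj_free (gen y) \<doteq> adj_free (gen y) * gen x" if "x \<in> G" "y \<in> G" for x y
    using that by (intro commute_adj_unitary comm unitary G)
  have comm'': "adj_free (gen x) * adj_free (gen y) \<doteq> adj_free (gen y) * adj_free (gen x)"
    if "x \<in> G" "y \<in> G" for x y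
    using eqv_adj[OF comm[OF that]] by (simp add: adj_free_mult eqv_sym)
  fix x assume x: "x \<in> G"
  show "gen x * h \<doteq> h * gen x"
    by (rule eqv_sym, rule commute_induct[OF assms(5) G(1)[OF x] comm[OF _ x] eqv_sym[OF comm'[OF x]]])
  show "adj_free (gen x) * h \<doteq> h * adj_free (gen x)"
    by (rule eqv_sym, rule commute_induct[OF assms(5) G(2)[OF x] comm'[OF _ x] comm''[OF _ x]])
qed

end

subsection \<open>Products of spectral projections\<close>

text \<open>The factors need not commute, so the product runs along a list; with the order fixed, a
  product of sums still expands into a sum over all choice functions.\<close>

lemma sum_PiE_prod_list:
  fixes h :: "'c \<Rightarrow> 'a \<Rightarrow> 'r::semiring_1"
  assumes "distinct xs"
  shows "(\<Sum>\<phi>\<in>set xs \<rightarrow>\<^sub>E K. \<Prod>x\<leftarrow>xs. h (\<phi> x) x) = (\<Prod>x\<leftarrow>xs. \<Sum>a\<in>K. h a x)"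
  using assms
proof (induction xs)
  case (Cons x xs)
  have PiE: "set (x # xs) \<rightarrow>\<^sub>E K = (\<lambda>(a, \<phi>). \<phi>(x := a)) ` (K \<times> (set xs \<rightarrow>\<^sub>E K))"
    by (simp add: PiE_insert_eq)
  have inj: "inj_on (\<lambda>(a, \<phi>). \<phi>(x := a)) (K \<times> (set xs \<rightarrow>\<^sub>E K))"
    using inj_combinator[of x "set xs" "\<lambda>_. K"] Cons.prems by simp
  have "(\<Sum>\<phi>\<in>set (x # xs) \<rightarrow>\<^sub>E K. \<Prod>z\<leftarrow>x # xs. h (\<phi> z) z) =
      (\<Sum>(a, \<phi>)\<in>K \<times> (set xs \<rightarrow>\<^sub>E K). h a x * (\<Prod>z\<leftarrow>xs. h ((\<phi>(x := a)) z) z))"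
    unfolding PiE sum.reindex[OF inj] by (simp add: case_prod_unfold)
  also have "\<dots> = (\<Sum>(a, \<phi>)\<in>K \<times> (set xs \<rightarrow>\<^sub>E K). h a x * (\<Prod>z\<leftarrow>xs. h (\<phi> z) z))"
  proof -
    have "map (\<lambda>z. h ((\<phi>(x := a)) z) z) xs = map (\<lambda>z. h (\<phi> z) z) xs" for a \<phi>
      using Cons.prems by auto
    then show ?thesis
      by (simp only: )
  qed
  also have "\<dots> = (\<Sum>a\<in>K. h a x) * (\<Sum>\<phi>\<in>set xs \<rightarrow>\<^sub>E K. \<Prod>z\<leftarrow>xs. h (\<phi> z) z)"
    by (simp add: sum_product sum.cartesian_product)
  finally show ?case
    using Cons by simp
qed simp

context
  fixes k :: nat and V :: "'v set"
  assumes k: "0 < k" and V: "finite V"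
begin

definition "CZ_rel = unitary_relations k V \<union> commutation_relations V"

lemma CZ_rel_FA: "CZ_rel \<subseteq> FA V"
  by (auto simp: CZ_rel_def unitary_relations_def commutation_relations_def FA_gen)

interpretation CZ: free_image V "CZ_abelian k V" "proj V CZ_rel"
  unfolding CZ_abelian_def using free_image_presented[OF CZ_rel_FA] by (simp add: CZ_rel_def)

lemma CZ_gen:
  assumes "x \<in> V"
  shows "CZ.eqv (adj_free (gen x) * gen x) 1" "CZ.eqv (gen x * adj_free (gen x)) 1"
    "CZ.eqv (gen x ^ k) 1"
    and "y \<in> V \<Longrightarrow> CZ.eqv (gen x * gen y) (gen y * gen x)"
proof -
  have "adj_free (gen x) * gen x - 1 \<in> CZ_rel" "gen x * adj_free (gen x) - 1 \<in> CZ_rel"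
    "gen x ^ k - 1 \<in> CZ_rel" "y \<in> V \<Longrightarrow> gen x * gen y - gen y * gen x \<in> CZ_rel"
    using assms by (auto simp: CZ_rel_def unitary_relations_def commutation_relations_def)
  then show "CZ.eqv (adj_free (gen x) * gen x) 1" "CZ.eqv (gen x * adj_free (gen x)) 1"
    "CZ.eqv (gen x ^ k) 1" "y \<in> V \<Longrightarrow> CZ.eqv (gen x * gen y) (gen y * gen x)"
    using assms by (simp_all add: presented_eqv[OF CZ_rel_FA] FA_gen)
qed

text \<open>\<open>Phi_abelian\<close> is a \<open>finprod\<close>, whose laws require a commutative
  monoid, whereas the relations impose commutation only on generators.\<close>

lemma cring_CZ: "cring (CZ_abelian k V)"
proof (intro cring.intro CZ.B.ring_axioms CZ.B.monoid_comm_monoidI)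
  fix x y assume "x \<in> carrier (CZ_abelian k V)" "y \<in> carrier (CZ_abelian k V)"
  then obtain f h where fh: "x = proj V CZ_rel f" "f \<in> FA V" "y = proj V CZ_rel h" "h \<in> FA V"
    using presented(4)[OF CZ_rel_FA] by (auto simp: CZ_abelian_def CZ_rel_def)
  have "CZ.eqv (f * h) (h * f)"
    by (rule CZ.commute_generators[OF CZ_gen(4) CZ_gen(1,2) fh(2,4)])
  then show "x \<otimes>\<^bsub>CZ_abelian k V\<^esub> y = y \<otimes>\<^bsub>CZ_abelian k V\<^esub> x"
    using fh by (simp add: CZ.eqv_def CZ.q_hom)
qed

interpretation CZ_cring: cring "CZ_abelian k V"
  by (rule cring_CZ)

abbreviation "CZ_spec \<phi> x \<equiv> proj V CZ_rel (spectral k (\<phi> x) (gen x))"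

lemma CZ_spec_closed [simp]: "x \<in> V \<Longrightarrow> CZ_spec \<phi> x \<in> carrier (CZ_abelian k V)"
  by (simp add: CZ.q_hom FA_gen)

lemma Phi_abelian_eq: "Phi_abelian k V \<phi> = (\<Otimes>\<^bsub>CZ_abelian k V\<^esub>x\<in>V. CZ_spec \<phi> x)"
proof -
  have "CZ_abelian_gen k V x = proj V CZ_rel (gen x)" for x
    by (simp add: CZ_abelian_gen_def presented_gen_def CZ_rel_def)
  then show ?thesis
    unfolding Phi_abelian_def
    by (intro CZ_cring.finprod_cong) (auto simp: CZ.spectral_proj_eq FA_gen simp_implies_def)
qed

lemma Phi_abelian_closed: "Phi_abelian k V \<phi> \<in> carrier (CZ_abelian k V)"
  unfolding Phi_abelian_eq by (rule CZ_cring.finprod_closed) auto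

lemma Phi_abelian_mult:
  assumes "\<phi> \<in> V \<rightarrow>\<^sub>E {0..<k}" "\<psi> \<in> V \<rightarrow>\<^sub>E {0..<k}"
  shows "Phi_abelian k V \<phi> \<otimes>\<^bsub>CZ_abelian k V\<^esub> Phi_abelian k V \<psi> =
    (if \<phi> = \<psi> then Phi_abelian k V \<phi> else \<zero>\<^bsub>CZ_abelian k V\<^esub>)"
proof -
  have *: "CZ_spec \<phi> x \<otimes>\<^bsub>CZ_abelian k V\<^esub> CZ_spec \<psi> x =
      (if \<phi> x = \<psi> x then CZ_spec \<phi> x else \<zero>\<^bsub>CZ_abelian k V\<^esub>)" if "x \<in> V" for x
  proof -
    have "\<phi> x < k" "\<psi> x < k"
      using assms that by auto
    then show ?thesis
      using CZ.eqvD(3)[OF CZ.spectral_mult[OF FA_gen[OF that] CZ_gen(1,3)[OF that] k, of "\<psi> x" "\<phi> x"]] that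
      by (simp add: CZ.q_hom FA_gen CZ.q_0 split: if_splits)
  qed
  have prod: "Phi_abelian k V \<phi> \<otimes>\<^bsub>CZ_abelian k V\<^esub> Phi_abelian k V \<psi> =
      (\<Otimes>\<^bsub>CZ_abelian k V\<^esub>x\<in>V. CZ_spec \<phi> x \<otimes>\<^bsub>CZ_abelian k V\<^esub> CZ_spec \<psi> x)"
    unfolding Phi_abelian_eq by (rule CZ_cring.finprod_multf[symmetric]) auto
  show ?thesis
  proof (cases "\<phi> = \<psi>")
    case True
    have "(\<Otimes>\<^bsub>CZ_abelian k V\<^esub>x\<in>V. CZ_spec \<phi> x \<otimes>\<^bsub>CZ_abelian k V\<^esub> CZ_spec \<phi> x) = Phi_abelian k V \<phi>"
      unfolding Phi_abelian_eq using * True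
      by (intro CZ_cring.finprod_cong) (auto simp: simp_implies_def)
    then show ?thesis
      using True prod by simp
  next
    case False
    \<comment> \<open>Elements of the extensional function space agree outside \<open>V\<close>, so
      distinct ones differ at a point of \<open>V\<close>; the factor at that point is zero and is
      split off next.\<close>
    then obtain x where x: "x \<in> V" "\<phi> x \<noteq> \<psi> x"
      using assms by (metis PiE_ext)
    have "(\<Otimes>\<^bsub>CZ_abelian k V\<^esub>x\<in>insert x (V - {x}). CZ_spec \<phi> x \<otimes>\<^bsub>CZ_abelian k V\<^esub> CZ_spec \<psi> x) =
        \<zero>\<^bsub>CZ_abelian k V\<^esub>"
      using x V by (subst CZ_cring.finprod_insert) (auto simp: * intro!: CZ_cring.finprod_closed)
    then show ?thesis
      using False x(1) by (simp add: prod insert_absorb)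
  qed
qed

lemma Phi_abelian_adj:
  assumes "\<phi> \<in> V \<rightarrow>\<^sub>E {0..<k}"
  shows "adj (CZ_abelian k V) (Phi_abelian k V \<phi>) = Phi_abelian k V \<phi>"
proof -
  have *: "adj (CZ_abelian k V) (CZ_spec \<phi> x) = CZ_spec \<phi> x" if "x \<in> V" for x
  proof -
    have "\<phi> x < k"
      using assms that by auto
    then show ?thesis
      using CZ.eqvD(3)[OF CZ.spectral_adj[OF FA_gen[OF that] CZ_gen(1,3)[OF that] k, of "\<phi> x"]] that
      by (simp add: CZ.q_hom FA_gen)
  qed
  \<comment> \<open>The adjoint reverses the product, and commutativity restores the order; the
    induction runs over subsets of \<open>V\<close>, where the factors are known to lie in the
    carrier.\<close>
  have "adj (CZ_abelian k V) (\<Otimes>\<^bsub>CZ_abelian k V\<^esub>x\<in>W. CZ_spec \<phi> x) = (\<Otimes>\<^bsub>CZ_abelian k V\<^esub>x\<in>W. CZ_spec \<phi> x)"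
    if "finite W" "W \<subseteq> V" for W
    using that
  proof (induction W)
    case empty
    then show ?case
      using CZ.q_hom(6)[of 1] by (simp add: CZ.q_hom)
  next
    case (insert x W)
    have "(\<Otimes>\<^bsub>CZ_abelian k V\<^esub>x\<in>W. CZ_spec \<phi> x) \<in> carrier (CZ_abelian k V)"
      using insert.prems by (intro CZ_cring.finprod_closed) auto
    moreover have "(\<Otimes>\<^bsub>CZ_abelian k V\<^esub>x\<in>insert x W. CZ_spec \<phi> x) =
        CZ_spec \<phi> x \<otimes>\<^bsub>CZ_abelian k V\<^esub> (\<Otimes>\<^bsub>CZ_abelian k V\<^esub>x\<in>W. CZ_spec \<phi> x)"
      using insert.prems insert.hyps by (intro CZ_cring.finprod_insert) auto
    ultimately show ?case
      using insert * by (simp add: CZ.B'.adj_mult CZ_cring.m_comm)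
  qed
  then show ?thesis
    unfolding Phi_abelian_eq using V by blast
qed

text \<open>For each x the projections sum to 1, and expanding the product of these sums over
  \<open>V\<close> gives one term per assignment. The expansion happens in the free algebra along an
  enumeration \<open>xs\<close> of \<open>V\<close>, where the product is ordered.\<close>

lemma sum_Phi_abelian:
  "(\<Oplus>\<^bsub>CZ_abelian k V\<^esub>\<phi>\<in>V \<rightarrow>\<^sub>E {0..<k}. Phi_abelian k V \<phi>) = \<one>\<^bsub>CZ_abelian k V\<^esub>"
proof -
  obtain xs where xs: "set xs = V" "distinct xs"
    using finite_distinct_list[OF V] by blast
  have prod: "proj V CZ_rel (\<Prod>x\<leftarrow>ys. spectral k (\<phi> x) (gen x)) = (\<Otimes>\<^bsub>CZ_abelian k V\<^esub>x\<in>set ys. CZ_spec \<phi> x)"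
    if "distinct ys" "set ys \<subseteq> V" for ys \<phi>
    using that
  proof (induction ys)
    case Nil
    then show ?case by (simp add: CZ.q_hom)
  next
    case (Cons y ys)
    have "(\<Otimes>\<^bsub>CZ_abelian k V\<^esub>x\<in>insert y (set ys). CZ_spec \<phi> x) =
        CZ_spec \<phi> y \<otimes>\<^bsub>CZ_abelian k V\<^esub> (\<Otimes>\<^bsub>CZ_abelian k V\<^esub>x\<in>set ys. CZ_spec \<phi> x)"
      using Cons.prems by (intro CZ_cring.finprod_insert) auto
    moreover have "(\<Prod>x\<leftarrow>ys. spectral k (\<phi> x) (gen x)) \<in> FA V"
      using Cons.prems by (intro FA_prod_list) (auto simp: FA_gen)
    ultimately show ?case
      using Cons by (simp add: CZ.q_hom FA_gen)
  qed
  have fa: "(\<Prod>x\<leftarrow>xs. spectral k (\<phi> x) (gen x)) \<in> FA V" for \<phi>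
    using xs by (intro FA_prod_list) (simp add: FA_gen)
  have "(\<Oplus>\<^bsub>CZ_abelian k V\<^esub>\<phi>\<in>V \<rightarrow>\<^sub>E {0..<k}. Phi_abelian k V \<phi>) =
      (\<Oplus>\<^bsub>CZ_abelian k V\<^esub>\<phi>\<in>V \<rightarrow>\<^sub>E {0..<k}. proj V CZ_rel (\<Prod>x\<leftarrow>xs. spectral k (\<phi> x) (gen x)))"
    using prod[of xs] xs by (simp add: Phi_abelian_eq)
  also have "\<dots> = proj V CZ_rel (\<Sum>\<phi>\<in>set xs \<rightarrow>\<^sub>E {0..<k}. \<Prod>x\<leftarrow>xs. spectral k (\<phi> x) (gen x))"
    using CZ.q_sum[of "V \<rightarrow>\<^sub>E {0..<k}", OF fa] xs by simp
  also have "(\<Sum>\<phi>\<in>set xs \<rightarrow>\<^sub>E {0..<k}. \<Prod>x\<leftarrow>xs. spectral k (\<phi> x) (gen x)) =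
      (\<Prod>x\<leftarrow>xs. \<Sum>a\<in>{0..<k}. spectral k a (gen x :: 'v free))"
    by (rule sum_PiE_prod_list[OF xs(2)])
  also have "\<dots> = (\<Prod>x\<leftarrow>xs. 1)"
    using k by (simp add: sum_spectral flip: lessThan_atLeast0)
  also have "(\<Prod>x\<leftarrow>xs. 1) = (1 :: 'v free)"
    by (induction xs) simp_all
  finally show ?thesis
    by (simp add: CZ.q_hom)
qed

lemma Phi_abelian_carrier: "Phi_abelian k V ` A \<subseteq> carrier (CZ_abelian k V)"
  using Phi_abelian_closed by auto

lemma CZ_star_algebra: "star_algebra (CZ_abelian k V)"
  by (rule CZ.star_algebra_B)

end

section \<open>The constraint algebra and its projections\<close>

lemma star_quot_zero:
  assumes "star_algebra A" "ideal J A" "x \<in> J"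
  shows "J +>\<^bsub>A\<^esub> x = \<zero>\<^bsub>star_quot A J\<^esub>"
  using ring.a_rcos_zero[OF star_algebra.axioms(1)[OF assms(1)] assms(2,3)]
  by (simp add: star_quot_def FactRing_simps)

context
  fixes k :: nat and V :: "'v set" and C :: "('v \<Rightarrow> nat) set"
  assumes k: "0 < k" and V: "finite V" and C: "C \<subseteq> V \<rightarrow>\<^sub>E {0..<k}"
begin

lemma constraint_algebra_hom:
  "star_hom (CZ_abelian k V) (constraint_algebra k V C)
    (\<lambda>x. constraint_ideal k V C +>\<^bsub>CZ_abelian k V\<^esub> x)"
  and star_algebra_constraint_algebra: "star_algebra (constraint_algebra k V C)"
proof -
  note CZ = CZ_star_algebra[OF k V]
  note J = star_ideal[OF CZ Phi_abelian_carrier[OF k V, where A = "(V \<rightarrow>\<^sub>E {0..<k}) - C"], folded constraint_ideal_def]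
  show "star_hom (CZ_abelian k V) (constraint_algebra k V C)
      (\<lambda>x. constraint_ideal k V C +>\<^bsub>CZ_abelian k V\<^esub> x)"
    unfolding constraint_algebra_def by (rule star_quot_hom(1)[OF CZ J(1)]) (rule J(3))
  show "star_algebra (constraint_algebra k V C)"
    unfolding constraint_algebra_def by (rule star_quot_hom(2)[OF CZ J(1)]) (rule J(3))
qed

lemma Phi_closed: "Phi k V C \<phi> \<in> carrier (constraint_algebra k V C)"
  unfolding Phi_def by (rule star_homD(1)[OF constraint_algebra_hom Phi_abelian_closed[OF k V]])

lemma Phi_adj:
  assumes "\<phi> \<in> C"
  shows "adj (constraint_algebra k V C) (Phi k V C \<phi>) = Phi k V C \<phi>"
proof -
  have "\<phi> \<in> V \<rightarrow>\<^sub>E {0..<k}"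
    using assms C by blast
  then show ?thesis
    unfolding Phi_def star_homD(6)[OF constraint_algebra_hom Phi_abelian_closed[OF k V], symmetric]
    by (simp only: Phi_abelian_adj[OF k V])
qed

lemma Phi_mult:
  assumes "\<phi> \<in> C" "\<psi> \<in> C"
  shows "Phi k V C \<phi> \<otimes>\<^bsub>constraint_algebra k V C\<^esub> Phi k V C \<psi> =
    (if \<phi> = \<psi> then Phi k V C \<phi> else \<zero>\<^bsub>constraint_algebra k V C\<^esub>)"
proof -
  have "\<phi> \<in> V \<rightarrow>\<^sub>E {0..<k}" "\<psi> \<in> V \<rightarrow>\<^sub>E {0..<k}"
    using assms C by blast+
  note mult = Phi_abelian_mult[OF k V this]
  note zero = star_hom_zero[OF CZ_star_algebra[OF k V] star_algebra_constraint_algebra constraint_algebra_hom]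
  show ?thesis
    unfolding Phi_def mult zero[symmetric]
      star_homD(3)[OF constraint_algebra_hom Phi_abelian_closed[OF k V] Phi_abelian_closed[OF k V], symmetric]
    by (rule if_distrib)
qed

text \<open>The unit is the sum over all assignments, and those outside \<open>C\<close> are
  generators of the ideal that is divided out.\<close>

lemma sum_Phi: "(\<Oplus>\<^bsub>constraint_algebra k V C\<^esub>\<phi>\<in>C. Phi k V C \<phi>) = \<one>\<^bsub>constraint_algebra k V C\<^esub>"
proof -
  let ?A = "CZ_abelian k V" and ?B = "constraint_algebra k V C"
  note CZ = CZ_star_algebra[OF k V]
  interpret B: ring ?B
    using star_algebra_constraint_algebra by (rule star_algebra.axioms)
  have zero: "Phi k V C \<phi> = \<zero>\<^bsub>?B\<^esub>" if "\<phi> \<in> (V \<rightarrow>\<^sub>E {0..<k}) - C" for \<phi>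
  proof -
    have "Phi_abelian k V \<phi> \<in> constraint_ideal k V C"
      unfolding constraint_ideal_def using that
      by (intro subsetD[OF star_ideal(2)[OF CZ Phi_abelian_carrier[OF k V]]] imageI)
    then show ?thesis
      unfolding Phi_def constraint_algebra_def constraint_ideal_def
      by (intro star_quot_zero CZ star_ideal(1) Phi_abelian_carrier[OF k V])
  qed
  have "\<one>\<^bsub>?B\<^esub> = (\<Oplus>\<^bsub>?B\<^esub>\<phi>\<in>V \<rightarrow>\<^sub>E {0..<k}. Phi k V C \<phi>)"
    unfolding Phi_def star_homD(4)[OF constraint_algebra_hom, symmetric] sum_Phi_abelian[OF k V, symmetric]
    by (rule star_hom_finsum[OF CZ star_algebra_constraint_algebra constraint_algebra_hom
        Phi_abelian_closed[OF k V]])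
  also have "\<dots> = (\<Oplus>\<^bsub>?B\<^esub>\<phi>\<in>C. Phi k V C \<phi>)"
    using C V zero Phi_closed
    by (intro B.add.finprod_mono_neutral_cong_right) (auto intro!: finite_PiE)
  finally show ?thesis
    by simp
qed

end

subsection \<open>The cyclic order on representatives\<close>

context free_image
begin

text \<open>With lists, adding two witnesses is concatenation. The negative of a commutator is again
  a commutator, so both have this property: elements that differ by commutators are below each other
  in \<open>le\<close>.\<close>

definition pos :: "'g free \<Rightarrow> bool" where
  "pos f \<longleftrightarrow> (\<exists>cs ds. set cs \<subseteq> FA G \<and> set ds \<subseteq> FA G \<times> FA G \<and>
     f \<doteq> (\<Sum>c\<leftarrow>cs. adj_free c * c) + (\<Sum>(u, v)\<leftarrow>ds. u * v - v * u))"

definition le :: "'g free \<Rightarrow> 'g free \<Rightarrow> bool" (infix \<open>\<preceq>\<close> 50) where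
  "f \<preceq> g \<longleftrightarrow> f \<in> FA G \<and> g \<in> FA G \<and> pos (g - f)"

lemma pos_FA: "pos f \<Longrightarrow> f \<in> FA G"
  by (auto simp: pos_def eqv_def)

lemma pos_eqv: "f \<doteq> g \<Longrightarrow> pos g \<Longrightarrow> pos f"
  unfolding pos_def by (blast intro: eqv_trans)

lemma pos_square: "c \<in> FA G \<Longrightarrow> pos (adj_free c * c)"
  unfolding pos_def by (rule exI[of _ "[c]"], rule exI[of _ "[]"]) (simp add: eqv_refl)

lemma pos_commutator: "u \<in> FA G \<Longrightarrow> v \<in> FA G \<Longrightarrow> pos (u * v - v * u)"
  unfolding pos_def by (rule exI[of _ "[]"], rule exI[of _ "[(u, v)]"]) (simp add: eqv_refl)

lemma pos_0: "pos 0"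
  using pos_square[of 0] by simp

lemma pos_add:
  assumes "pos f" "pos g"
  shows "pos (f + g)"
proof -
  obtain cs ds where f: "set cs \<subseteq> FA G" "set ds \<subseteq> FA G \<times> FA G"
      "f \<doteq> (\<Sum>c\<leftarrow>cs. adj_free c * c) + (\<Sum>(u, v)\<leftarrow>ds. u * v - v * u)"
    using assms(1) unfolding pos_def by blast
  obtain cs' ds' where g: "set cs' \<subseteq> FA G" "set ds' \<subseteq> FA G \<times> FA G"
      "g \<doteq> (\<Sum>c\<leftarrow>cs'. adj_free c * c) + (\<Sum>(u, v)\<leftarrow>ds'. u * v - v * u)"
    using assms(2) unfolding pos_def by blast
  show ?thesis
    unfolding pos_def
  proof (intro exI conjI)
    show "set (cs @ cs') \<subseteq> FA G" "set (ds @ ds') \<subseteq> FA G \<times> FA G"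
      using f g by auto
    show "f + g \<doteq> (\<Sum>c\<leftarrow>cs @ cs'. adj_free c * c) + (\<Sum>(u, v)\<leftarrow>ds @ ds'. u * v - v * u)"
      using eqv_add[OF f(3) g(3)] by (simp add: algebra_simps)
  qed
qed

lemma pos_sc:
  assumes "pos f" "0 \<le> r"
  shows "pos (sc (of_real r) * f)"
proof -
  obtain cs ds where f: "set cs \<subseteq> FA G" "set ds \<subseteq> FA G \<times> FA G"
      "f \<doteq> (\<Sum>c\<leftarrow>cs. adj_free c * c) + (\<Sum>(u, v)\<leftarrow>ds. u * v - v * u)"
    using assms(1) unfolding pos_def by blast
  let ?r = "complex_of_real r" and ?s = "complex_of_real (sqrt r)"
  show ?thesis
    unfolding pos_def
  proof (intro exI conjI)
    \<comment> \<open>A square absorbs \<open>r\<close> through its square root, while a commutator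
      takes \<open>r\<close> into its first entry.\<close>
    show "set (map ((*) (sc ?s)) cs) \<subseteq> FA G" "set (map (\<lambda>(u, v). (sc ?r * u, v)) ds) \<subseteq> FA G \<times> FA G"
      using f by auto
    have sq: "adj_free (sc ?s * c) * (sc ?s * c) = sc ?r * (adj_free c * c)" for c :: "'g free"
    proof -
      have "adj_free (sc ?s * c) * (sc ?s * c) = sc ?s * (adj_free c * (sc ?s * c))"
        by (simp add: adj_free_scale mult.assoc)
      also have "\<dots> = sc (?s * ?s) * (adj_free c * c)"
        unfolding sc_left_commute[of "adj_free c"] sc_mult_assoc ..
      also have "?s * ?s = ?r"
        using assms(2) by (simp flip: of_real_mult)
      finally show ?thesis .
    qed
    have comm: "sc ?r * u * v - v * (sc ?r * u) = sc ?r * (u * v - v * u)" for u v :: "'g free"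
      unfolding sc_left_commute[of v] by (simp add: algebra_simps)
    have "sc ?r * ((\<Sum>c\<leftarrow>cs. adj_free c * c) + (\<Sum>(u, v)\<leftarrow>ds. u * v - v * u)) =
        (\<Sum>c\<leftarrow>map ((*) (sc ?s)) cs. adj_free c * c) +
        (\<Sum>(u, v)\<leftarrow>map (\<lambda>(u, v). (sc ?r * u, v)) ds. u * v - v * u)"
      by (simp add: distrib_left sum_list_const_mult[symmetric] comp_def sq comm case_prod_unfold)
    then show "sc ?r * f \<doteq> (\<Sum>c\<leftarrow>map ((*) (sc ?s)) cs. adj_free c * c) +
        (\<Sum>(u, v)\<leftarrow>map (\<lambda>(u, v). (sc ?r * u, v)) ds. u * v - v * u)"
      using eqv_sc[OF f(3), of ?r] by simp
  qed
qed

lemma pos_sum: "(\<And>i. i \<in> I \<Longrightarrow> pos (f i)) \<Longrightarrow> pos (\<Sum>i\<in>I. f i)"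
  by (induction I rule: infinite_finite_induct) (auto intro: pos_0 pos_add)

lemma leD: "f \<preceq> g \<Longrightarrow> f \<in> FA G" "f \<preceq> g \<Longrightarrow> g \<in> FA G" "f \<preceq> g \<Longrightarrow> pos (g - f)"
  by (simp_all add: le_def)

lemma le_0_iff: "0 \<preceq> f \<longleftrightarrow> pos f"
  using pos_FA by (auto simp: le_def)

lemma le_eqv: "f \<doteq> g \<Longrightarrow> f \<preceq> g"
  using pos_eqv[OF eqv_diff[OF eqv_refl, of g f g]] pos_0 by (simp add: le_def eqvD)

lemma le_refl: "f \<in> FA G \<Longrightarrow> f \<preceq> f"
  by (simp add: le_eqv eqv_refl)

lemma le_trans [trans]: "f \<preceq> g \<Longrightarrow> g \<preceq> h \<Longrightarrow> f \<preceq> h"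
  using pos_add[of "g - f" "h - g"] by (simp add: le_def)

lemma le_eqv_trans [trans]: "f \<preceq> g \<Longrightarrow> g \<doteq> h \<Longrightarrow> f \<preceq> h"
  by (blast intro: le_trans le_eqv)

lemma eqv_le_trans [trans]: "f \<doteq> g \<Longrightarrow> g \<preceq> h \<Longrightarrow> f \<preceq> h"
  by (blast intro: le_trans le_eqv)

lemma le_add: "f \<preceq> f' \<Longrightarrow> g \<preceq> g' \<Longrightarrow> f + g \<preceq> f' + g'"
  using pos_add[of "f' - f" "g' - g"] by (simp add: le_def algebra_simps)

lemma le_sum: "(\<And>i. i \<in> I \<Longrightarrow> f i \<preceq> g i) \<Longrightarrow> (\<Sum>i\<in>I. f i) \<preceq> (\<Sum>i\<in>I. g i)"
  by (induction I rule: infinite_finite_induct) (simp_all add: le_add le_refl)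

lemma le_sc: "f \<preceq> g \<Longrightarrow> 0 \<le> r \<Longrightarrow> sc (of_real r) * f \<preceq> sc (of_real r) * g"
  using pos_sc[of "g - f" r] by (simp add: le_def right_diff_distrib)

lemma le_sc_mono:
  assumes "0 \<preceq> f" "r \<le> s"
  shows "sc (of_real r) * f \<preceq> sc (of_real s) * f"
  using pos_sc[of f "s - r"] assms by (simp add: le_def single_diff left_diff_distrib)

text \<open>Exchanging the roles of \<open>u\<close> and \<open>v\<close> gives the reverse
  inequality, so this is cyclic equivalence rather than a proper estimate.\<close>

lemma le_commute: "u \<in> FA G \<Longrightarrow> v \<in> FA G \<Longrightarrow> u * v \<preceq> v * u"
  using pos_commutator[of v u] by (simp add: le_def)

lemma q_sum_list:
  assumes "\<And>x. x \<in> set xs \<Longrightarrow> h x \<in> FA G"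
  shows "q (\<Sum>x\<leftarrow>xs. h x) = (\<Oplus>\<^bsub>B\<^esub>j\<in>{..<length xs}. q (h (xs ! j)))"
  using q_sum[of "{..<length xs}" "\<lambda>j. h (xs ! j)"] assms
  by (simp add: sum_list_sum_nth flip: lessThan_atLeast0)

text \<open>The return from representatives to the algebra: the lists of witnesses become the
  indexed families asked for by \<open>cyclic_le\<close>.\<close>

lemma cyclic_le_q:
  assumes "f \<preceq> g"
  shows "cyclic_le B (q f) (q g)"
proof -
  obtain cs ds where cs: "set cs \<subseteq> FA G" and ds: "set ds \<subseteq> FA G \<times> FA G"
    and fg: "g - f \<doteq> (\<Sum>c\<leftarrow>cs. adj_free c * c) + (\<Sum>(u, v)\<leftarrow>ds. u * v - v * u)"
    using leD(3)[OF assms] unfolding pos_def by blast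
  have cs_nth: "cs ! j \<in> FA G" if "j < length cs" for j
    using cs that nth_mem by blast
  have ds_nth: "fst (ds ! j) \<in> FA G" "snd (ds ! j) \<in> FA G" if "j < length ds" for j
    using ds nth_mem[OF that] by auto
  have S: "(\<Sum>c\<leftarrow>cs. adj_free c * c) \<in> FA G" "(\<Sum>(u, v)\<leftarrow>ds. u * v - v * u) \<in> FA G"
    using cs_nth ds_nth by (auto simp: sum_list_sum_nth case_prod_unfold intro!: FA_sum)
  have "q g \<ominus>\<^bsub>B\<^esub> q f = q (g - f)"
    using leD[OF assms] by (simp add: q_diff)
  also have "\<dots> = q (\<Sum>c\<leftarrow>cs. adj_free c * c) \<oplus>\<^bsub>B\<^esub> q (\<Sum>(u, v)\<leftarrow>ds. u * v - v * u)"
    unfolding eqvD(3)[OF fg] by (rule q_hom(2)[OF S])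
  also have "q (\<Sum>c\<leftarrow>cs. adj_free c * c) =
      (\<Oplus>\<^bsub>B\<^esub>j\<in>{..<length cs}. adj B (q (cs ! j)) \<otimes>\<^bsub>B\<^esub> q (cs ! j))"
    using cs cs_nth by (subst q_sum_list) (auto intro!: B.finsum_cong simp: q_hom B'.adj_closed simp_implies_def)
  also have "q (\<Sum>(u, v)\<leftarrow>ds. u * v - v * u) =
      (\<Oplus>\<^bsub>B\<^esub>l\<in>{..<length ds}. (q (fst (ds ! l)) \<otimes>\<^bsub>B\<^esub> q (snd (ds ! l))) \<ominus>\<^bsub>B\<^esub>
        (q (snd (ds ! l)) \<otimes>\<^bsub>B\<^esub> q (fst (ds ! l))))"
    using ds ds_nth unfolding case_prod_unfold
    by (subst q_sum_list) (auto intro!: B.finsum_cong simp: q_hom q_diff simp_implies_def)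
  finally show ?thesis
    unfolding cyclic_le_def using cs_nth ds_nth q_hom(1)
    by (intro exI[of _ "length cs"] exI[of _ "\<lambda>j. q (cs ! j)"] exI[of _ "length ds"]
        exI[of _ "\<lambda>l. q (fst (ds ! l))"] exI[of _ "\<lambda>l. q (snd (ds ! l))"]) simp
qed

end

subsection \<open>Projection-valued measures\<close>

text \<open>The five commutators bring all mixed products into the orders p r, p q and r q.
  Multiples are written as repeated sums, so distributivity alone proves the identity in any
  ring.\<close>

lemma triangle_identity:
  fixes p q r :: "'r::ring"
  shows "(p - (q + q) + r) * (p - (q + q) + r) + (p * r - r * p) + (q * p - p * q) +
      (q * p - p * q) + (q * r - r * q) + (q * r - r * q) =
    p * p + q * q + q * q + q * q + q * q + r * r + p * r + p * r -
      p * q - p * q - p * q - p * q - r * q - r * q - r * q - r * q"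
  by (simp add: distrib_left distrib_right left_diff_distrib right_diff_distrib)

context free_image
begin

definition projection :: "'g free \<Rightarrow> bool" where
  "projection e \<longleftrightarrow> adj_free e \<doteq> e \<and> e * e \<doteq> e"

text \<open>Mutual orthogonality is kept for \<open>orthogonal_pvm\<close>: the triangle inequality
  argues with idempotence and total 1, while marginals need the cross products to vanish.\<close>

definition pvm :: "'i set \<Rightarrow> ('i \<Rightarrow> 'g free) \<Rightarrow> bool" where
  "pvm I e \<longleftrightarrow> (\<forall>i\<in>I. projection (e i)) \<and> (\<Sum>i\<in>I. e i) \<doteq> 1"

lemma projection_FA: "projection e \<Longrightarrow> e \<in> FA G"
  by (auto simp: projection_def dest: eqvD)

lemma projection_diff_1:
  assumes "projection e"
  shows "projection (1 - e)"
proof -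
  note e = assms[unfolded projection_def] projection_FA[OF assms]
  have "adj_free (1 - e) \<doteq> 1 - e"
    using e by (simp add: adj_free_diff eqv_diff eqv_refl)
  moreover have "(1 - e) * (1 - e) \<doteq> 1 - e"
  proof -
    have "(1 - e) * (1 - e) = 1 - e - e + e * e"
      by (simp add: algebra_simps)
    also have "\<dots> \<doteq> 1 - e - e + e"
      using e by (intro eqv_add eqv_refl) simp_all
    finally show ?thesis
      by simp
  qed
  ultimately show ?thesis
    by (simp add: projection_def)
qed

text \<open>The square of p r is r p r, and moving one r around the cycle gives p r. The first
  direction bounds the squares of the constraint-constraint side by linear terms; the second turns
  linear terms back into the squares of the constraint-variable side.\<close>

lemma projection_product_square:
  assumes "projection p" "projection r"
  shows "adj_free (p * r) * (p * r) \<preceq> p * r" "p * r \<preceq> adj_free (p * r) * (p * r)"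
proof -
  note p = assms(1)[unfolded projection_def] projection_FA[OF assms(1)]
  note r = assms(2)[unfolded projection_def] projection_FA[OF assms(2)]
  have "adj_free (p * r) * (p * r) = (adj_free r * adj_free p) * (p * r)"
    by (simp add: adj_free_mult)
  also have "\<dots> \<doteq> (r * p) * (p * r)"
    using p r by (intro eqv_mult_right[OF _ eqv_mult]) simp_all
  also have "\<dots> = r * ((p * p) * r)"
    by (simp add: mult.assoc)
  also have "\<dots> \<doteq> r * (p * r)"
    using p r by (intro eqv_mult_left[OF _ eqv_mult_right]) simp_all
  finally have 1: "adj_free (p * r) * (p * r) \<doteq> r * (p * r)" .
  have 2: "(p * r) * r \<doteq> p * r"
    unfolding mult.assoc using p r by (intro eqv_mult_left) simp_all
  note 1
  also have "r * (p * r) \<preceq> (p * r) * r"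
    using p r by (intro le_commute) simp_all
  also note 2
  finally show "adj_free (p * r) * (p * r) \<preceq> p * r" .
  note eqv_sym[OF 2]
  also have "(p * r) * r \<preceq> r * (p * r)"
    using p r by (intro le_commute) simp_all
  also note eqv_sym[OF 1]
  finally show "p * r \<preceq> adj_free (p * r) * (p * r)" .
qed

lemma projection_product_nonneg:
  assumes "projection p" "projection r"
  shows "0 \<preceq> p * r"
proof -
  have "0 \<preceq> adj_free (p * r) * (p * r)"
    using assms by (simp add: le_0_iff pos_square projection_FA)
  also have "\<dots> \<preceq> p * r"
    using assms by (rule projection_product_square)
  finally show ?thesis .
qed

text \<open>The right-hand side minus the left-hand side is, up to commutators, half of the sum of the
  squares of \<open>P a - 2 * Q a + R a\<close>.\<close>

lemma pvm_triangle:
  assumes "pvm I P" "pvm I Q" "pvm I R"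
  shows "1 - (\<Sum>a\<in>I. P a * R a) \<preceq>
    (1 - (\<Sum>a\<in>I. P a * Q a)) + (1 - (\<Sum>a\<in>I. P a * Q a)) +
    ((1 - (\<Sum>a\<in>I. R a * Q a)) + (1 - (\<Sum>a\<in>I. R a * Q a)))"
    (is "?l \<preceq> ?r")
proof -
  have proj: "projection (P a)" "projection (Q a)" "projection (R a)" if "a \<in> I" for a
    using that assms by (auto simp: pvm_def)
  note FA = projection_FA[OF proj(1)] projection_FA[OF proj(2)] projection_FA[OF proj(3)]
  define s where "s a = P a - (Q a + Q a) + R a" for a
  define T where "T a = s a * s a + (P a * R a - R a * P a) + (Q a * P a - P a * Q a) +
    (Q a * P a - P a * Q a) + (Q a * R a - R a * Q a) + (Q a * R a - R a * Q a)" for a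
  have sFA: "s a \<in> FA G" if "a \<in> I" for a
    using FA[OF that] by (simp add: s_def)
  have "pos (T a)" if "a \<in> I" for a
  proof -
    have adj_s: "adj_free (s a) \<doteq> s a"
      using proj[OF that] unfolding s_def projection_def
      by (auto simp: adj_free_add adj_free_diff intro!: eqv_add eqv_diff)
    have "pos (s a * s a)"
      using pos_eqv[OF eqv_mult_right[OF sFA[OF that] eqv_sym[OF adj_s]]] pos_square[OF sFA[OF that]] .
    then show ?thesis
      unfolding T_def using FA[OF that] by (intro pos_add pos_commutator)
  qed
  then have T: "pos (\<Sum>a\<in>I. T a)"
    by (rule pos_sum)
  have idem: "(\<Sum>a\<in>I. e a * e a) \<doteq> 1" if "pvm I e" for e
  proof -
    have "(\<Sum>a\<in>I. e a * e a) \<doteq> (\<Sum>a\<in>I. e a)"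
      using that unfolding pvm_def projection_def by (intro eqv_sum) auto
    also have "\<dots> \<doteq> 1"
      using that by (simp add: pvm_def)
    finally show ?thesis .
  qed
  have T_eq: "T a = P a * P a + Q a * Q a + Q a * Q a + Q a * Q a + Q a * Q a + R a * R a +
      P a * R a + P a * R a - P a * Q a - P a * Q a - P a * Q a - P a * Q a -
      R a * Q a - R a * Q a - R a * Q a - R a * Q a" for a
    unfolding T_def s_def by (rule triangle_identity)
  define PR where "PR = (\<Sum>a\<in>I. P a * R a)"
  define PQ where "PQ = (\<Sum>a\<in>I. P a * Q a)"
  define RQ where "RQ = (\<Sum>a\<in>I. R a * Q a)"
  have FA': "PR \<in> FA G" "PQ \<in> FA G" "RQ \<in> FA G"
    unfolding PR_def PQ_def RQ_def using FA by (auto intro!: FA_sum FA_mult)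
  \<comment> \<open>The gap is doubled to avoid halves. Its six units are replaced by sums of
    squares: one for \<open>P\<close>, four for \<open>Q\<close> and one for \<open>R\<close>, as in
    \<open>triangle_identity\<close>.\<close>
  have "(?r - ?l) + (?r - ?l) =
      1 + 1 + 1 + 1 + 1 + 1 + PR + PR - PQ - PQ - PQ - PQ - RQ - RQ - RQ - RQ"
    unfolding PR_def[symmetric] PQ_def[symmetric] RQ_def[symmetric] by (simp add: algebra_simps)
  also have "\<dots> \<doteq> (\<Sum>a\<in>I. P a * P a) + (\<Sum>a\<in>I. Q a * Q a) + (\<Sum>a\<in>I. Q a * Q a) +
      (\<Sum>a\<in>I. Q a * Q a) + (\<Sum>a\<in>I. Q a * Q a) + (\<Sum>a\<in>I. R a * R a) + PR + PR -
      PQ - PQ - PQ - PQ - RQ - RQ - RQ - RQ"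
    using FA' by (intro eqv_diff eqv_add eqv_refl eqv_sym[OF idem] assms)
  also have "\<dots> = (\<Sum>a\<in>I. T a)"
    unfolding T_eq PR_def PQ_def RQ_def by (simp add: sum.distrib sum_subtractf)
  finally have "pos ((?r - ?l) + (?r - ?l))"
    using T by (rule pos_eqv)
  then have "pos (sc (of_real (1 / 2)) * ((?r - ?l) + (?r - ?l)))"
    by (rule pos_sc) simp
  moreover have "sc (of_real (1 / 2)) * (x + x) = x" for x :: "'g free"
  proof -
    have "sc (of_real (1 / 2)) * (x + x) = (sc (1 / 2) + sc (1 / 2)) * x"
      by (simp add: distrib_left distrib_right)
    also have "sc (1 / 2) + sc (1 / 2) = (1 :: 'g free)"
      by (simp flip: single_add)
    finally show ?thesis
      by simp
  qed
  ultimately have "pos (?r - ?l)"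
    by simp
  then show ?thesis
    using FA' by (simp add: le_def PR_def PQ_def RQ_def)
qed

text \<open>Push-forward of \<open>p\<close> along \<open>f\<close>. For \<open>f\<close> the
  evaluation at a variable it stands in for the spectral projection of that variable inside a
  constraint algebra, expressed through the assignments.\<close>

definition marginal :: "'t set \<Rightarrow> ('t \<Rightarrow> 'g free) \<Rightarrow> ('t \<Rightarrow> 'c) \<Rightarrow> 'c \<Rightarrow> 'g free" where
  "marginal C p f a = (\<Sum>t\<in>C. if f t = a then p t else 0)"

text \<open>Change of variables: each \<open>t\<close> contributes to exactly one \<open>a\<close>
  in \<open>K\<close>, namely \<open>f t\<close>. Taking \<open>h\<close> constantly 1 gives the
  total mass.\<close>

lemma sum_marginal:
  assumes "finite K" "f ` C \<subseteq> K"
  shows "(\<Sum>a\<in>K. marginal C p f a * h a) = (\<Sum>t\<in>C. p t * h (f t))"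
proof -
  have "(\<Sum>a\<in>K. marginal C p f a * h a) = (\<Sum>t\<in>C. \<Sum>a\<in>K. if f t = a then p t * h a else 0)"
    unfolding marginal_def sum_distrib_right
    by (subst sum.swap) (simp add: if_distrib[of "\<lambda>x. x * _"] cong: if_cong)
  also have "\<dots> = (\<Sum>t\<in>C. p t * h (f t))"
    using assms by (intro sum.cong) (auto simp: sum.delta)
  finally show ?thesis .
qed

definition orthogonal_pvm :: "'t set \<Rightarrow> ('t \<Rightarrow> 'g free) \<Rightarrow> bool" where
  "orthogonal_pvm C p \<longleftrightarrow> finite C \<and> pvm C p \<and> (\<forall>s\<in>C. \<forall>t\<in>C. s \<noteq> t \<longrightarrow> p s * p t \<doteq> 0)"

lemma pvm_marginal:
  assumes "orthogonal_pvm C p" "finite K" "f ` C \<subseteq> K"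
  shows "pvm K (marginal C p f)"
proof -
  have C: "finite C" and proj: "\<And>t. t \<in> C \<Longrightarrow> projection (p t)" and sum: "(\<Sum>t\<in>C. p t) \<doteq> 1"
    and orth: "\<And>s t. s \<in> C \<Longrightarrow> t \<in> C \<Longrightarrow> s \<noteq> t \<Longrightarrow> p s * p t \<doteq> 0"
    using assms(1) by (auto simp: orthogonal_pvm_def pvm_def)
  have "(\<Sum>a\<in>K. marginal C p f a) = (\<Sum>t\<in>C. p t)"
    using sum_marginal[OF assms(2,3), of p "\<lambda>_. 1"] by simp
  moreover have "projection (marginal C p f a)" for a
  proof -
    have adj: "adj_free (marginal C p f a) \<doteq> marginal C p f a"
      unfolding marginal_def adj_free_sum using proj
      by (intro eqv_sum) (auto simp: projection_def eqv_refl)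
    have "marginal C p f a * marginal C p f a =
        (\<Sum>s\<in>C. \<Sum>t\<in>C. (if f s = a then p s else 0) * (if f t = a then p t else 0))"
      unfolding marginal_def by (rule sum_product)
    \<comment> \<open>Orthogonality leaves only the diagonal of the double sum.\<close>
    also have "\<dots> \<doteq> (\<Sum>s\<in>C. \<Sum>t\<in>C. if s = t then if f s = a then p s else 0 else 0)"
      using proj orth by (intro eqv_sum) (auto simp: projection_def eqv_refl)
    also have "\<dots> = marginal C p f a"
      using C by (simp add: marginal_def)
    finally show ?thesis
      using adj by (simp add: projection_def)
  qed
  ultimately show ?thesis
    using sum by (simp add: pvm_def)
qed

subsection \<open>The main inequality\<close>

text \<open>By change of variables the defect is the sum of \<open>p t * (1 - Q (f t))\<close>, the
  mass of outcomes that \<open>Q\<close> does not confirm. Each summand is a product of two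
  projections, so it is nonnegative and cyclically equal to its square.\<close>

lemma pvm_defect:
  fixes k :: nat
  assumes p: "orthogonal_pvm C p" and f: "f ` C \<subseteq> {..<k}" and Q: "pvm {..<k} Q"
  shows "0 \<preceq> 1 - (\<Sum>a<k. marginal C p f a * Q a)"
    and "1 - (\<Sum>a<k. marginal C p f a * Q a) \<preceq>
      (\<Sum>t\<in>C. adj_free (p t * (1 - Q (f t))) * (p t * (1 - Q (f t))))"
proof -
  have C: "finite C" and proj: "\<And>t. t \<in> C \<Longrightarrow> projection (p t)" and sum: "(\<Sum>t\<in>C. p t) \<doteq> 1"
    using p by (auto simp: orthogonal_pvm_def pvm_def)
  have proj': "projection (1 - Q (f t))" if "t \<in> C" for t
    using that f Q by (intro projection_diff_1) (auto simp: pvm_def)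
  have Q_FA: "Q (f t) \<in> FA G" if "t \<in> C" for t
    using that f Q by (intro projection_FA) (auto simp: pvm_def)
  have "(\<Sum>t\<in>C. p t * (1 - Q (f t))) = (\<Sum>t\<in>C. p t) - (\<Sum>t\<in>C. p t * Q (f t))"
    by (simp add: right_diff_distrib sum_subtractf)
  also have "\<dots> \<doteq> 1 - (\<Sum>t\<in>C. p t * Q (f t))"
    using proj Q_FA by (intro eqv_diff sum eqv_refl FA_sum) (simp add: projection_FA)
  also have "(\<Sum>t\<in>C. p t * Q (f t)) = (\<Sum>a<k. marginal C p f a * Q a)"
    using f by (intro sum_marginal[symmetric]) auto
  finally have eq: "(\<Sum>t\<in>C. p t * (1 - Q (f t))) \<doteq> 1 - (\<Sum>a<k. marginal C p f a * Q a)" .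
  have "0 = (\<Sum>t\<in>C. (0 :: 'g free))"
    by simp
  also have "\<dots> \<preceq> (\<Sum>t\<in>C. p t * (1 - Q (f t)))"
    by (intro le_sum projection_product_nonneg proj proj')
  also note eq
  finally show "0 \<preceq> 1 - (\<Sum>a<k. marginal C p f a * Q a)" .
  note eqv_sym[OF eq]
  also have "(\<Sum>t\<in>C. p t * (1 - Q (f t))) \<preceq>
      (\<Sum>t\<in>C. adj_free (p t * (1 - Q (f t))) * (p t * (1 - Q (f t))))"
    by (intro le_sum projection_product_square proj proj')
  finally show "1 - (\<Sum>a<k. marginal C p f a * Q a) \<preceq>
      (\<Sum>t\<in>C. adj_free (p t * (1 - Q (f t))) * (p t * (1 - Q (f t))))" .
qed

text \<open>All pairs together have mass 1 * 1; a change of variables identifies the mass of the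
  agreeing pairs, and the rest is disagreement.\<close>

lemma pvm_disagreement:
  fixes k :: nat
  assumes p: "orthogonal_pvm C p" and r: "orthogonal_pvm D r"
    and f: "f ` C \<subseteq> {..<k}" "g ` D \<subseteq> {..<k}"
  shows "(\<Sum>s\<in>C. \<Sum>t\<in>D. if f s \<noteq> g t then p s * r t else 0) \<doteq>
    1 - (\<Sum>a<k. marginal C p f a * marginal D r g a)"
proof -
  have sum: "(\<Sum>s\<in>C. p s) \<doteq> 1" "(\<Sum>t\<in>D. r t) \<doteq> 1"
    using p r by (auto simp: orthogonal_pvm_def pvm_def)
  have FA: "p s \<in> FA G" "r t \<in> FA G" if "s \<in> C" "t \<in> D" for s t
    using p r that by (auto simp: orthogonal_pvm_def pvm_def projection_FA)
  have agree: "(\<Sum>a<k. marginal C p f a * marginal D r g a) =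
      (\<Sum>s\<in>C. \<Sum>t\<in>D. if f s = g t then p s * r t else 0)"
  proof -
    have "(\<Sum>a<k. marginal C p f a * marginal D r g a) = (\<Sum>s\<in>C. p s * marginal D r g (f s))"
      using f by (intro sum_marginal) auto
    also have "\<dots> = (\<Sum>s\<in>C. \<Sum>t\<in>D. if f s = g t then p s * r t else 0)"
      unfolding marginal_def sum_distrib_left by (intro sum.cong) auto
    finally show ?thesis .
  qed
  have "(\<Sum>s\<in>C. \<Sum>t\<in>D. if f s \<noteq> g t then p s * r t else 0) =
      (\<Sum>s\<in>C. \<Sum>t\<in>D. p s * r t - (if f s = g t then p s * r t else 0))"
    by (intro sum.cong) auto
  also have "\<dots> = (\<Sum>s\<in>C. p s) * (\<Sum>t\<in>D. r t) - (\<Sum>a<k. marginal C p f a * marginal D r g a)"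
    unfolding agree by (simp add: sum_subtractf sum_product)
  also have "\<dots> \<doteq> 1 * 1 - (\<Sum>a<k. marginal C p f a * marginal D r g a)"
    unfolding agree using FA by (intro eqv_diff eqv_mult sum eqv_refl FA_sum) auto
  finally show ?thesis
    by simp
qed

text \<open>A union bound over the common variables is followed by the triangle inequality through
  \<open>Q x\<close> at each of them. The sums are then enlarged from \<open>V \<inter> W\<close> to
  the full scopes, over which the constraint-variable weights run; nonnegativity of the defects
  permits this.\<close>

lemma consistency_le_defect:
  fixes C D :: "('v \<Rightarrow> nat) set"
  assumes p: "orthogonal_pvm C p" and r: "orthogonal_pvm D r"
    and V: "finite V" "\<And>\<phi> x. \<phi> \<in> C \<Longrightarrow> x \<in> V \<Longrightarrow> \<phi> x < k"
    and W: "finite W" "\<And>\<psi> x. \<psi> \<in> D \<Longrightarrow> x \<in> W \<Longrightarrow> \<psi> x < k"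
    and Q: "\<And>x. x \<in> V \<union> W \<Longrightarrow> pvm {..<k} (Q x)"
  shows "(\<Sum>\<phi>\<in>C. \<Sum>\<psi>\<in>D. if restrict \<phi> (V \<inter> W) \<noteq> restrict \<psi> (V \<inter> W)
      then adj_free (p \<phi> * r \<psi>) * (p \<phi> * r \<psi>) else 0) \<preceq>
    (\<Sum>x\<in>V. 1 - (\<Sum>a<k. marginal C p (\<lambda>\<phi>. \<phi> x) a * Q x a)) +
    (\<Sum>x\<in>V. 1 - (\<Sum>a<k. marginal C p (\<lambda>\<phi>. \<phi> x) a * Q x a)) +
    ((\<Sum>x\<in>W. 1 - (\<Sum>a<k. marginal D r (\<lambda>\<psi>. \<psi> x) a * Q x a)) +
     (\<Sum>x\<in>W. 1 - (\<Sum>a<k. marginal D r (\<lambda>\<psi>. \<psi> x) a * Q x a)))"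
proof -
  define E where "E x = 1 - (\<Sum>a<k. marginal C p (\<lambda>\<phi>. \<phi> x) a * Q x a)" for x
  define F where "F x = 1 - (\<Sum>a<k. marginal D r (\<lambda>\<psi>. \<psi> x) a * Q x a)" for x
  have proj: "projection (p \<phi>)" "projection (r \<psi>)" if "\<phi> \<in> C" "\<psi> \<in> D" for \<phi> \<psi>
    using p r that by (auto simp: orthogonal_pvm_def pvm_def)
  have E: "0 \<preceq> E x" if "x \<in> V" for x
    unfolding E_def using that V Q by (intro pvm_defect(1)[OF p]) auto
  have F: "0 \<preceq> F x" if "x \<in> W" for x
    unfolding F_def using that W Q by (intro pvm_defect(1)[OF r]) auto
  have mono: "(\<Sum>x\<in>V \<inter> W. h x) \<preceq> (\<Sum>x\<in>U. h x)"
    if "finite U" "V \<inter> W \<subseteq> U" "\<And>x. x \<in> U \<Longrightarrow> 0 \<preceq> h x" for h and U :: "'v set"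
  proof -
    have "(\<Sum>x\<in>V \<inter> W. h x) + 0 \<preceq> (\<Sum>x\<in>V \<inter> W. h x) + (\<Sum>x\<in>U - V \<inter> W. h x)"
      using that by (intro le_add le_refl FA_sum) (auto simp: le_0_iff intro: pos_sum pos_FA)
    then show ?thesis
      using that by (simp add: sum.subset_diff[of "V \<inter> W" U] add.commute)
  qed
  have pointwise: "(if restrict \<phi> (V \<inter> W) \<noteq> restrict \<psi> (V \<inter> W)
        then adj_free (p \<phi> * r \<psi>) * (p \<phi> * r \<psi>) else 0) \<preceq>
      (\<Sum>x\<in>V \<inter> W. if \<phi> x \<noteq> \<psi> x then p \<phi> * r \<psi> else 0)" if "\<phi> \<in> C" "\<psi> \<in> D" for \<phi> \<psi>
  proof -
    have nonneg: "0 \<preceq> (if b then p \<phi> * r \<psi> else 0)" for b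
      using projection_product_nonneg[OF proj[OF that]] by (simp add: le_refl)
    have nonneg': "0 \<preceq> (\<Sum>x\<in>U. if \<phi> x \<noteq> \<psi> x then p \<phi> * r \<psi> else 0)" for U
      unfolding le_0_iff by (rule pos_sum) (use nonneg[unfolded le_0_iff] in blast)
    show ?thesis
    proof (cases "restrict \<phi> (V \<inter> W) = restrict \<psi> (V \<inter> W)")
      case True
      then show ?thesis
        using nonneg' by simp
    next
      case False
      then obtain x where x: "x \<in> V \<inter> W" "\<phi> x \<noteq> \<psi> x"
        by (metis restrict_ext)
      have "adj_free (p \<phi> * r \<psi>) * (p \<phi> * r \<psi>) \<preceq> p \<phi> * r \<psi>"
        using proj[OF that] by (rule projection_product_square)
      also have "p \<phi> * r \<psi> = p \<phi> * r \<psi> + 0"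
        by simp
      \<comment> \<open>The other common variables contribute zero or another copy of the same
        nonnegative product.\<close>
      also have "\<dots> \<preceq> p \<phi> * r \<psi> + (\<Sum>x\<in>V \<inter> W - {x}. if \<phi> x \<noteq> \<psi> x then p \<phi> * r \<psi> else 0)"
        using proj[OF that] by (intro le_add le_refl nonneg') (simp add: projection_FA)
      also have "\<dots> = (\<Sum>x\<in>V \<inter> W. if \<phi> x \<noteq> \<psi> x then p \<phi> * r \<psi> else 0)"
        using x V(1) by (simp add: sum.remove[of "V \<inter> W" x])
      finally show ?thesis
        using False by simp
    qed
  qed
  have single: "(\<Sum>\<phi>\<in>C. \<Sum>\<psi>\<in>D. if \<phi> x \<noteq> \<psi> x then p \<phi> * r \<psi> else 0) \<preceq> E x + E x + (F x + F x)"
    if "x \<in> V \<inter> W" for x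
  proof -
    have im: "(\<lambda>\<phi>. \<phi> x) ` C \<subseteq> {..<k}" "(\<lambda>\<psi>. \<psi> x) ` D \<subseteq> {..<k}"
      using that V W by auto
    note pvm_disagreement[OF p r im]
    also have "1 - (\<Sum>a<k. marginal C p (\<lambda>\<phi>. \<phi> x) a * marginal D r (\<lambda>\<psi>. \<psi> x) a) \<preceq> E x + E x + (F x + F x)"
      unfolding E_def F_def using that Q
      by (intro pvm_triangle pvm_marginal[OF p] pvm_marginal[OF r] im) auto
    finally show ?thesis .
  qed
  have "(\<Sum>\<phi>\<in>C. \<Sum>\<psi>\<in>D. if restrict \<phi> (V \<inter> W) \<noteq> restrict \<psi> (V \<inter> W)
      then adj_free (p \<phi> * r \<psi>) * (p \<phi> * r \<psi>) else 0) \<preceq>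
      (\<Sum>\<phi>\<in>C. \<Sum>\<psi>\<in>D. \<Sum>x\<in>V \<inter> W. if \<phi> x \<noteq> \<psi> x then p \<phi> * r \<psi> else 0)"
    by (intro le_sum pointwise)
  also have "\<dots> = (\<Sum>\<phi>\<in>C. \<Sum>x\<in>V \<inter> W. \<Sum>\<psi>\<in>D. if \<phi> x \<noteq> \<psi> x then p \<phi> * r \<psi> else 0)"
    by (intro sum.cong refl sum.swap)
  also have "\<dots> = (\<Sum>x\<in>V \<inter> W. \<Sum>\<phi>\<in>C. \<Sum>\<psi>\<in>D. if \<phi> x \<noteq> \<psi> x then p \<phi> * r \<psi> else 0)"
    by (rule sum.swap)
  also have "\<dots> \<preceq> (\<Sum>x\<in>V \<inter> W. E x + E x + (F x + F x))"
    by (intro le_sum single)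
  also have "\<dots> = (\<Sum>x\<in>V \<inter> W. E x) + (\<Sum>x\<in>V \<inter> W. E x) + ((\<Sum>x\<in>V \<inter> W. F x) + (\<Sum>x\<in>V \<inter> W. F x))"
    by (simp add: sum.distrib)
  also have "\<dots> \<preceq> (\<Sum>x\<in>V. E x) + (\<Sum>x\<in>V. E x) + ((\<Sum>x\<in>W. F x) + (\<Sum>x\<in>W. F x))"
    using V(1) W(1) E F by (intro le_add mono) auto
  finally show ?thesis
    unfolding E_def F_def .
qed

text \<open>A pair (i, j) costs twice the defect of i plus twice that of j. Averaging with
  \<open>w\<close> leaves four times the marginal weight of i on its defect; the scope size L pays
  for the division by \<open>card (V i)\<close>.\<close>

lemma weighted_consistency_le_defect:
  fixes C :: "'i \<Rightarrow> ('v \<Rightarrow> nat) set" and w :: "'i \<Rightarrow> 'i \<Rightarrow> real"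
  assumes p: "\<And>i. i \<in> I \<Longrightarrow> orthogonal_pvm (C i) (p i)"
    and V: "\<And>i. i \<in> I \<Longrightarrow> finite (V i)" "\<And>i \<phi> x. i \<in> I \<Longrightarrow> \<phi> \<in> C i \<Longrightarrow> x \<in> V i \<Longrightarrow> \<phi> x < k"
    and Q: "\<And>i x. i \<in> I \<Longrightarrow> x \<in> V i \<Longrightarrow> pvm {..<k} (Q x)"
    and w: "\<And>i j. 0 \<le> w i j" "\<And>i j. w i j = w j i"
    and L: "\<And>i. i \<in> I \<Longrightarrow> card (V i) \<le> L"
  shows "(\<Sum>i\<in>I. \<Sum>j\<in>I. sc (of_real (w i j)) * (\<Sum>\<phi>\<in>C i. \<Sum>\<psi>\<in>C j.
      if restrict \<phi> (V i \<inter> V j) \<noteq> restrict \<psi> (V i \<inter> V j)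
      then adj_free (p i \<phi> * p j \<psi>) * (p i \<phi> * p j \<psi>) else 0)) \<preceq>
    sc (of_real (4 * real L)) * (\<Sum>i\<in>I. sc (of_real ((\<Sum>j\<in>I. w i j) / card (V i))) *
      (\<Sum>x\<in>V i. \<Sum>\<phi>\<in>C i.
        adj_free (p i \<phi> * (1 - Q x (\<phi> x))) * (p i \<phi> * (1 - Q x (\<phi> x)))))"
proof -
  define D where "D i = (\<Sum>x\<in>V i. 1 - (\<Sum>a<k. marginal (C i) (p i) (\<lambda>\<phi>. \<phi> x) a * Q x a))" for i
  define E where "E i = (\<Sum>x\<in>V i. \<Sum>\<phi>\<in>C i.
    adj_free (p i \<phi> * (1 - Q x (\<phi> x))) * (p i \<phi> * (1 - Q x (\<phi> x))))" for i
  define w' where "w' i = (\<Sum>j\<in>I. w i j)" for i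
  have D_nonneg: "0 \<preceq> D i" and DE: "D i \<preceq> E i" if "i \<in> I" for i
  proof -
    have "pos (D i)"
      unfolding D_def using that V Q p
      by (intro pos_sum pvm_defect(1)[unfolded le_0_iff]) auto
    then show "0 \<preceq> D i"
      by (simp add: le_0_iff)
    show "D i \<preceq> E i"
      unfolding D_def E_def using that V Q p
      by (intro le_sum pvm_defect(2)) auto
  qed
  have "(\<Sum>i\<in>I. \<Sum>j\<in>I. sc (of_real (w i j)) * (\<Sum>\<phi>\<in>C i. \<Sum>\<psi>\<in>C j.
      if restrict \<phi> (V i \<inter> V j) \<noteq> restrict \<psi> (V i \<inter> V j)
      then adj_free (p i \<phi> * p j \<psi>) * (p i \<phi> * p j \<psi>) else 0)) \<preceq>
      (\<Sum>i\<in>I. \<Sum>j\<in>I. sc (of_real (w i j)) * (D i + D i + (D j + D j)))"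
    unfolding D_def using V Q
    by (intro le_sum le_sc w consistency_le_defect p) auto
  also have "\<dots> = (\<Sum>i\<in>I. sc (of_real (4 * w' i)) * D i)"
  proof -
    define Z where "Z = (\<Sum>i\<in>I. \<Sum>j\<in>I. sc (of_real (w i j)) * D i)"
    have Z: "Z = (\<Sum>i\<in>I. sc (of_real (w' i)) * D i)"
      by (simp add: Z_def w'_def sc_sum sum_distrib_right)
    \<comment> \<open>Exchanging the sums and using symmetry of \<open>w\<close> turns the defects
      of the second index into those of the first.\<close>
    have "(\<Sum>i\<in>I. \<Sum>j\<in>I. sc (of_real (w i j)) * D j) = Z"
      unfolding Z_def by (subst sum.swap) (simp add: w(2))
    then have "(\<Sum>i\<in>I. \<Sum>j\<in>I. sc (of_real (w i j)) * (D i + D i + (D j + D j))) = Z + Z + (Z + Z)"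
      by (simp add: distrib_left sum.distrib flip: Z_def)
    also have "\<dots> = 4 * Z"
    proof -
      have "(4 :: 'g free) = 1 + 1 + (1 + 1)"
        by simp
      then show ?thesis
        by (simp only: distrib_right mult_1_left)
    qed
    also have "\<dots> = (\<Sum>i\<in>I. sc (of_real (4 * w' i)) * D i)"
      unfolding Z sum_distrib_left sc_numeral[symmetric] sc_mult_assoc by simp
    finally show ?thesis .
  qed
  also have "\<dots> \<preceq> (\<Sum>i\<in>I. sc (of_real (4 * real L * (w' i / card (V i)))) * E i)"
  proof (rule le_sum)
    fix i assume i: "i \<in> I"
    have w': "0 \<le> w' i"
      unfolding w'_def using w(1) by (rule sum_nonneg)
    have "sc (of_real (4 * w' i)) * D i \<preceq> sc (of_real (4 * real L * (w' i / card (V i)))) * D i"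
    proof (cases "V i = {}")
      \<comment> \<open>For an empty scope the quotient by \<open>card (V i)\<close> is 0 by
        convention, so the coefficients cannot be compared; but then \<open>D i\<close> is an empty
        sum.\<close>
      case True
      then show ?thesis
        by (simp add: D_def le_refl)
    next
      case False
      then have "0 < card (V i)"
        using V(1)[OF i] by (simp add: card_gt_0_iff)
      then have "4 * w' i \<le> 4 * real L * (w' i / card (V i))"
        using mult_right_mono[OF _ w', of "real (card (V i))" "real L"] L[OF i] by (simp add: field_simps)
      then show ?thesis
        using D_nonneg[OF i] by (rule le_sc_mono[rotated])
    qed
    also have "\<dots> \<preceq> sc (of_real (4 * real L * (w' i / card (V i)))) * E i"
      using DE[OF i] w' by (intro le_sc) simp_all
    finally show "sc (of_real (4 * w' i)) * D i \<preceq> sc (of_real (4 * real L * (w' i / card (V i)))) * E i" .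
  qed
  also have "\<dots> = sc (of_real (4 * real L)) * (\<Sum>i\<in>I. sc (of_real (w' i / card (V i))) * E i)"
    unfolding sum_distrib_left sc_mult_assoc of_real_mult ..
  finally show ?thesis
    unfolding E_def w'_def .
qed

end

subsection \<open>Listed weights\<close>

lemma listed_weight_cong:
  "(\<And>t. t \<in> T \<Longrightarrow> w t = w' t) \<Longrightarrow> (\<And>t. t \<in> T \<Longrightarrow> e t = e' t) \<Longrightarrow>
    listed_weight T w e = listed_weight T w' e'"
  unfolding listed_weight_def by (rule ext, rule sum.cong) auto

lemma listed_weight_support: "{a. listed_weight T w e a \<noteq> 0} \<subseteq> e ` T"
proof
  fix a assume "a \<in> {a. listed_weight T w e a \<noteq> 0}"
  then have "{t \<in> T. e t = a} \<noteq> {}"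
    unfolding listed_weight_def by (metis (mono_tags, lifting) mem_Collect_eq sum.empty)
  then show "a \<in> e ` T"
    by blast
qed

lemma weighted_star_algebra_listed:
  assumes "star_algebra A" "finite T" "\<And>t. t \<in> T \<Longrightarrow> 0 \<le> w t" "\<And>t. t \<in> T \<Longrightarrow> e t \<in> carrier A"
  shows "weighted_star_algebra A (listed_weight T w e)"
proof (intro weighted_star_algebra.intro weighted_star_algebra_axioms.intro assms(1))
  show "0 \<le> listed_weight T w e a" for a
    unfolding listed_weight_def using assms(3) by (intro sum_nonneg) auto
  show "finite {a. listed_weight T w e a \<noteq> 0}"
    by (rule finite_subset[OF listed_weight_support]) (simp add: assms(2))
  show "{a. listed_weight T w e a \<noteq> 0} \<subseteq> carrier A"
    using listed_weight_support[of T w e] assms(4) by blast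
qed

section \<open>Weighted square sums and spectral measures on representatives\<close>

context free_image
begin

text \<open>Different indices may name the same element of the quotient, where their weights are
  added. Grouping \<open>T\<close> by the fibres of \<open>q (e t)\<close> shows that the sum over
  elements equals the sum over indices.\<close>

lemma weighted_square_sum_listed:
  assumes T: "finite T" and e: "\<And>t. t \<in> T \<Longrightarrow> e t \<in> FA G"
  shows "weighted_square_sum B (listed_weight T w (\<lambda>t. q (e t))) =
    q (\<Sum>t\<in>T. sc (of_real (w t)) * (adj_free (e t) * e t))"
proof -
  let ?u = "listed_weight T w (\<lambda>t. q (e t))"
  let ?supp = "{a. ?u a \<noteq> 0}" and ?im = "(\<lambda>t. q (e t)) ` T"
  \<comment> \<open>One representative per element of the quotient, shared by its whole fibre; at
    the end it is exchanged for \<open>e t\<close>, to which it is congruent.\<close>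
  define \<rho> where "\<rho> a = (SOME f. f \<in> FA G \<and> q f = a)" for a
  have \<rho>: "\<rho> a \<in> FA G" "q (\<rho> a) = a" if "a \<in> ?im" for a
    using that e someI_ex[of "\<lambda>f. f \<in> FA G \<and> q f = a"] unfolding \<rho>_def by auto
  have supp: "?supp \<subseteq> ?im"
    by (rule listed_weight_support)
  have "weighted_square_sum B ?u = (\<Oplus>\<^bsub>B\<^esub>a\<in>?supp. q (sc (of_real (?u a)) * (adj_free (\<rho> a) * \<rho> a)))"
    unfolding weighted_square_sum_def
  proof (rule B.finsum_cong')
    show "(\<lambda>a. q (sc (of_real (?u a)) * (adj_free (\<rho> a) * \<rho> a))) \<in> ?supp \<rightarrow> carrier B"
      using supp \<rho> by (auto intro!: q_hom(1))
    show "module.smult B (of_real (?u a)) (adj B a \<otimes>\<^bsub>B\<^esub> a) = q (sc (of_real (?u a)) * (adj_free (\<rho> a) * \<rho> a))"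
      if "a \<in> ?supp" for a
    proof -
      have a: "a \<in> ?im"
        using supp that by blast
      show ?thesis
        unfolding q_hom(5)[OF FA_mult[OF FA_adj[OF \<rho>(1)[OF a]] \<rho>(1)[OF a]]]
        using \<rho>[OF a] by (simp add: q_hom(3,6))
    qed
  qed simp
  also have "\<dots> = q (\<Sum>a\<in>?supp. sc (of_real (?u a)) * (adj_free (\<rho> a) * \<rho> a))"
    using supp \<rho> by (intro q_sum[symmetric]) (auto intro!: FA_mult FA_adj)
  \<comment> \<open>The image can exceed the support when the weights on a fibre add up to 0; the
    extra terms vanish.\<close>
  also have "(\<Sum>a\<in>?supp. sc (of_real (?u a)) * (adj_free (\<rho> a) * \<rho> a)) =
      (\<Sum>a\<in>?im. sc (of_real (?u a)) * (adj_free (\<rho> a) * \<rho> a))"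
    using supp T by (intro sum.mono_neutral_left) auto
  also have "\<dots> = (\<Sum>a\<in>?im. \<Sum>t\<in>{t \<in> T. q (e t) = a}.
      sc (of_real (w t)) * (adj_free (\<rho> (q (e t))) * \<rho> (q (e t))))"
    by (intro sum.cong refl) (simp add: listed_weight_def sc_sum sum_distrib_right)
  also have "\<dots> = (\<Sum>t\<in>T. sc (of_real (w t)) * (adj_free (\<rho> (q (e t))) * \<rho> (q (e t))))"
    using T by (rule sum.image_gen[symmetric])
  also have "q \<dots> = q (\<Sum>t\<in>T. sc (of_real (w t)) * (adj_free (e t) * e t))"
  proof (rule eqvD(3), rule eqv_sum, rule eqv_sc)
    fix t assume t: "t \<in> T"
    have "\<rho> (q (e t)) \<doteq> e t"
      using \<rho>[of "q (e t)"] e[OF t] t by (simp add: eqv_def)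
    then show "adj_free (\<rho> (q (e t))) * \<rho> (q (e t)) \<doteq> adj_free (e t) * e t"
      by (intro eqv_mult eqv_adj)
  qed
  finally show ?thesis .
qed

lemma pvm_spectral:
  assumes "f \<in> FA G" "adj_free f * f \<doteq> 1" "f ^ k \<doteq> 1" "0 < k"
  shows "pvm {..<k} (\<lambda>a. spectral k a f)"
  unfolding pvm_def projection_def
proof (intro conjI ballI)
  fix a assume "a \<in> {..<k}"
  then show "adj_free (spectral k a f) \<doteq> spectral k a f"
    "spectral k a f * spectral k a f \<doteq> spectral k a f"
    using spectral_adj[OF assms, of a] spectral_mult[OF assms, of a a] by auto
next
  show "(\<Sum>a<k. spectral k a f) \<doteq> 1"
    unfolding sum_spectral[OF assms(4)] by (simp add: eqv_refl)
qed

end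

subsection \<open>Inclusions into free products\<close>

lemma hom_relations_FA:
  assumes "star_algebra A" "e ` carrier A \<subseteq> G"
  shows "hom_relations A e \<subseteq> FA G"
proof -
  interpret A: ring A
    using assms(1) by (rule star_algebra.axioms)
  note A = star_algebra.smult_mem[OF assms(1)] star_algebra.adj_closed[OF assms(1)]
  have "gen (e a) \<in> FA G" if "a \<in> carrier A" for a
    using that assms(2) by (intro FA_gen) auto
  then show ?thesis
    using A by (auto simp: hom_relations_def mult_map_scale_conv_mult)
qed

text \<open>The relations refer to generators only through \<open>e\<close>, so renaming just
  composes the embedding with \<open>r\<close>.\<close>

lemma map_free_hom_relations:
  "map_free r ` hom_relations A e \<subseteq> hom_relations A (r \<circ> e)"
  unfolding hom_relations_def image_Un
  by (rule Un_mono)+ (force simp: map_free_diff map_free_add map_free_mult map_free_adj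
      mult_map_scale_conv_mult map_free_single)+

text \<open>The algebraic clauses of \<open>star_hom\<close> are precisely the relations collected
  in \<open>hom_relations\<close>, which vanish in the quotient.\<close>

lemma star_hom_presented_gen:
  assumes A: "star_algebra A" and R: "R \<subseteq> FA G" "hom_relations A e \<subseteq> R" and e: "e ` carrier A \<subseteq> G"
  shows "star_hom A (presented G R) (\<lambda>a. proj G R (gen (e a)))"
proof -
  interpret A: ring A
    using A by (rule star_algebra.axioms)
  interpret q: free_image G "presented G R" "proj G R"
    using R(1) by (rule free_image_presented)
  note A' = star_algebra.smult_mem[OF A] star_algebra.adj_closed[OF A]
  have gen: "gen (e a) \<in> FA G" if "a \<in> carrier A" for a
    using that e by (intro FA_gen) auto
  have eqv: "proj G R f = proj G R g" if "f - g \<in> hom_relations A e" "f \<in> FA G" "g \<in> FA G" for f g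
    using that R by (intro q.eqvD(3) presented_eqv[OF R(1)]) auto
  show ?thesis
  proof (rule star_homI)
    fix a b assume a: "a \<in> carrier A" and b: "b \<in> carrier A"
    have "gen (e (a \<oplus>\<^bsub>A\<^esub> b)) - (gen (e a) + gen (e b)) \<in> hom_relations A e"
      using a b unfolding hom_relations_def by blast
    from eqv[OF this] show "proj G R (gen (e (a \<oplus>\<^bsub>A\<^esub> b))) =
        proj G R (gen (e a)) \<oplus>\<^bsub>presented G R\<^esub> proj G R (gen (e b))"
      using a b gen by (simp add: q.q_hom(2))
    have "gen (e (a \<otimes>\<^bsub>A\<^esub> b)) - gen (e a) * gen (e b) \<in> hom_relations A e"
      using a b unfolding hom_relations_def by blast
    from eqv[OF this] show "proj G R (gen (e (a \<otimes>\<^bsub>A\<^esub> b))) =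
        proj G R (gen (e a)) \<otimes>\<^bsub>presented G R\<^esub> proj G R (gen (e b))"
      using a b gen by (simp add: q.q_hom(3))
  next
    fix a assume a: "a \<in> carrier A"
    show "proj G R (gen (e a)) \<in> carrier (presented G R)"
      using gen[OF a] by (rule q.q_hom(1))
    have "gen (e (adj A a)) - adj_free (gen (e a)) \<in> hom_relations A e"
      using a unfolding hom_relations_def by blast
    from eqv[OF this] show "proj G R (gen (e (adj A a))) = adj (presented G R) (proj G R (gen (e a)))"
      using a gen A' by (simp add: q.q_hom(6))
    have "gen (e (module.smult A c a)) - sc c * gen (e a) \<in> hom_relations A e" for c
      using a unfolding hom_relations_def mult_map_scale_conv_mult by blast
    from eqv[OF this] show "proj G R (gen (e (module.smult A c a))) =
        module.smult (presented G R) c (proj G R (gen (e a)))" for c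
      using a gen A' by (simp add: q.q_hom(5))
  next
    have "gen (e \<one>\<^bsub>A\<^esub>) - 1 \<in> hom_relations A e"
      unfolding hom_relations_def by blast
    from eqv[OF this] show "proj G R (gen (e \<one>\<^bsub>A\<^esub>)) = \<one>\<^bsub>presented G R\<^esub>"
      using gen by (simp add: q.q_hom(4))
  qed
qed

lemma fp_relations_FA:
  assumes "\<And>i. i \<in> I \<Longrightarrow> star_algebra (A i)"
  shows "fp_relations I A \<subseteq> FA (fp_generators I A)"
  unfolding fp_relations_def
proof (rule UN_least)
  fix i assume "i \<in> I"
  then show "hom_relations (A i) (\<lambda>a. (i, a)) \<subseteq> FA (fp_generators I A)"
    using assms by (intro hom_relations_FA) (auto simp: fp_generators_def)
qed

lemma fp1_relations_FA:
  assumes "\<And>i. i \<in> I \<Longrightarrow> star_algebra (A i)" "star_algebra B"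
  shows "fp1_relations I A B \<subseteq> FA (fp1_generators I A B)"
  unfolding fp1_relations_def
proof (intro Un_least UN_least)
  fix i assume "i \<in> I"
  then show "hom_relations (A i) (\<lambda>a. Inl (i, a)) \<subseteq> FA (fp1_generators I A B)"
    using assms by (intro hom_relations_FA) (auto simp: fp1_generators_def)
next
  show "hom_relations B Inr \<subseteq> FA (fp1_generators I A B)"
    using assms by (intro hom_relations_FA) (auto simp: fp1_generators_def)
qed

text \<open>Renaming by \<open>Inl\<close> sends relations to relations, so it descends to the
  quotients. The second conclusion gives the value on representatives, which is how the image of the
  weighted sum is computed.\<close>

lemma free_product_into_free_product1:
  assumes A: "\<And>i. i \<in> I \<Longrightarrow> star_algebra (A i)" and B: "star_algebra B"
  obtains \<alpha> where "star_hom (free_product I A) (free_product1 I A B) \<alpha>"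
    and "\<And>f. f \<in> FA (fp_generators I A) \<Longrightarrow> \<alpha> (proj (fp_generators I A) (fp_relations I A) f) =
      proj (fp1_generators I A B) (fp1_relations I A B) (map_free Inl f)"
proof -
  let ?G = "fp_generators I A" and ?R = "fp_relations I A"
  let ?G1 = "fp1_generators I A B" and ?R1 = "fp1_relations I A B"
  note R = fp_relations_FA[of I A, OF A] and R1 = fp1_relations_FA[of I A, OF A B]
  have hom: "star_hom (free_star_algebra ?G) (presented ?G1 ?R1) (proj ?G1 ?R1 \<circ> map_free Inl)"
    by (intro star_hom_comp[OF star_hom_map_free presented(2)] R1)
      (auto simp: fp_generators_def fp1_generators_def)
  have zero: "(proj ?G1 ?R1 \<circ> map_free Inl) r = \<zero>\<^bsub>presented ?G1 ?R1\<^esub>" if "r \<in> ?R" for r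
  proof -
    have "map_free Inl r \<in> ?R1"
      using that map_free_hom_relations[of "Inl :: _ \<Rightarrow> _ + 'c"]
      unfolding fp_relations_def fp1_relations_def comp_def by blast
    then show ?thesis
      using presented(3)[OF R1] by simp
  qed
  obtain \<alpha> where "star_hom (star_quot (free_star_algebra ?G) (star_ideal (free_star_algebra ?G) ?R)) (presented ?G1 ?R1) \<alpha>"
    "\<And>f. f \<in> FA ?G \<Longrightarrow> \<alpha> (proj ?G ?R f) = (proj ?G1 ?R1 \<circ> map_free Inl) f"
    using star_quot_lift[OF star_algebra_free presented(1)[OF R1] hom R zero] by blast
  then show ?thesis
    using that unfolding free_product_def free_product1_def presented_def by simp
qed

section \<open>Transport of projections and sums along homomorphisms\<close>

lemma map_free_sum: "map_free r (\<Sum>i\<in>I. h i) = (\<Sum>i\<in>I. map_free r (h i))"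
  by (induction I rule: infinite_finite_induct) (simp_all add: map_free_add)

lemma star_hom_nat_pow:
  assumes A: "star_algebra A" and h: "star_hom A B h" and x: "x \<in> carrier A"
  shows "h (x [^]\<^bsub>A\<^esub> (n::nat)) = h x [^]\<^bsub>B\<^esub> n"
proof -
  interpret A: ring A
    using A by (rule star_algebra.axioms)
  show ?thesis
    using x by (induction n) (simp_all add: star_homD[OF h])
qed

text \<open>Products, adjoints and the unit are preserved by the inclusion of a factor, so the
  projections of that factor remain an orthogonal resolution of the identity in
  \<open>B\<close>.\<close>

lemma orthogonal_pvm_Phi:
  assumes q: "free_image G B q"
    and k: "0 < k" and V: "finite V" and C: "C \<subseteq> V \<rightarrow>\<^sub>E {0..<k}"
    and hom: "star_hom (constraint_algebra k V C) B (\<lambda>a. q (gen (e a)))"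
    and e: "e ` carrier (constraint_algebra k V C) \<subseteq> G"
  shows "free_image.orthogonal_pvm G q C (\<lambda>\<phi>. gen (e (Phi k V C \<phi>)))"
proof -
  interpret free_image G B q
    by (rule q)
  let ?A = "constraint_algebra k V C" and ?h = "\<lambda>a. q (gen (e a))"
  note A = star_algebra_constraint_algebra[OF k V C]
  note closed = Phi_closed[OF k V C]
  note h = star_homD[OF hom]
  have FA: "gen (e (Phi k V C \<phi>)) \<in> FA G" for \<phi>
    using closed e by (intro FA_gen) auto
  have mult: "?h (Phi k V C \<phi>) \<otimes>\<^bsub>B\<^esub> ?h (Phi k V C \<psi>) =
      (if \<phi> = \<psi> then ?h (Phi k V C \<phi>) else \<zero>\<^bsub>B\<^esub>)" if "\<phi> \<in> C" "\<psi> \<in> C" for \<phi> \<psi>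
    unfolding h(3)[OF closed closed, symmetric] Phi_mult[OF k V C that]
      star_hom_zero[OF A star_algebra_B hom, symmetric] by (rule if_distrib)
  have "?h (Phi k V C \<phi>) = adj B (?h (Phi k V C \<phi>))" if "\<phi> \<in> C" for \<phi>
    unfolding h(6)[OF closed, symmetric] Phi_adj[OF k V C that] ..
  moreover have "(\<Oplus>\<^bsub>B\<^esub>\<phi>\<in>C. ?h (Phi k V C \<phi>)) = \<one>\<^bsub>B\<^esub>"
    unfolding star_hom_finsum[OF A star_algebra_B hom closed, symmetric] sum_Phi[OF k V C] by (rule h(4))
  moreover have "finite C"
    by (rule finite_subset[OF C]) (simp add: V finite_PiE)
  ultimately show ?thesis
    using FA mult
    by (simp add: orthogonal_pvm_def pvm_def projection_def eqv_def q_hom q_sum q_0)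
qed

section \<open>Sums over dependent tuples as iterated sums\<close>

lemma sum_over_Sigma:
  "finite A \<Longrightarrow> (\<And>x. x \<in> A \<Longrightarrow> finite (B x)) \<Longrightarrow> sum f (Sigma A B) = (\<Sum>x\<in>A. \<Sum>y\<in>B x. f (x, y))"
  by (simp add: sum.Sigma)

lemma sum_over_Sigma3:
  assumes "finite A" "\<And>x. x \<in> A \<Longrightarrow> finite (B x)" "\<And>x y. x \<in> A \<Longrightarrow> y \<in> B x \<Longrightarrow> finite (C x y)"
  shows "sum f (SIGMA x:A. SIGMA y:B x. C x y) = (\<Sum>x\<in>A. \<Sum>y\<in>B x. \<Sum>z\<in>C x y. f (x, y, z))"
proof -
  have "sum f (SIGMA x:A. SIGMA y:B x. C x y) = (\<Sum>x\<in>A. sum (\<lambda>t. f (x, t)) (SIGMA y:B x. C x y))"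
    by (intro sum_over_Sigma finite_SigmaI assms)
  also have "\<dots> = (\<Sum>x\<in>A. \<Sum>y\<in>B x. \<Sum>z\<in>C x y. f (x, y, z))"
    by (intro sum.cong refl sum_over_Sigma assms)
  finally show ?thesis .
qed

lemma sum_over_Sigma4:
  assumes "finite A" "\<And>x. x \<in> A \<Longrightarrow> finite (B x)" "\<And>x y. x \<in> A \<Longrightarrow> y \<in> B x \<Longrightarrow> finite (C x y)"
    "\<And>x y z. x \<in> A \<Longrightarrow> y \<in> B x \<Longrightarrow> z \<in> C x y \<Longrightarrow> finite (D x y z)"
  shows "sum f (SIGMA x:A. SIGMA y:B x. SIGMA z:C x y. D x y z) =
    (\<Sum>x\<in>A. \<Sum>y\<in>B x. \<Sum>z\<in>C x y. \<Sum>u\<in>D x y z. f (x, y, z, u))"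
proof -
  have "sum f (SIGMA x:A. SIGMA y:B x. SIGMA z:C x y. D x y z) =
      (\<Sum>x\<in>A. sum (\<lambda>t. f (x, t)) (SIGMA y:B x. SIGMA z:C x y. D x y z))"
    by (intro sum_over_Sigma finite_SigmaI assms)
  also have "\<dots> = (\<Sum>x\<in>A. \<Sum>y\<in>B x. \<Sum>z\<in>C x y. \<Sum>u\<in>D x y z. f (x, y, z, u))"
    by (intro sum.cong refl sum_over_Sigma3 assms)
  finally show ?thesis .
qed

section \<open>Assembly: the two weighted sums on representatives and their comparison\<close>

theorem lemma3p7:
  fixes k :: nat and S :: "'v constraint_system"
    and \<pi> :: "(nat \<times> nat) pmf" and \<pi>' :: "nat pmf" and L :: nat
  assumes "kary_constraint_system k S"
    and "set_pmf \<pi> \<subseteq> {1..ncons S} \<times> {1..ncons S}"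
    and "\<And>i j. pmf \<pi> (i, j) = pmf \<pi> (j, i)"
    and "set_pmf \<pi>' \<subseteq> {1..ncons S}"
    and "\<And>i. i \<in> {1..ncons S} \<Longrightarrow> pmf \<pi>' i = (\<Sum>j\<in>{1..ncons S}. pmf \<pi> (i, j))"
    and "L = Max ((\<lambda>i. card (scope S i)) ` {1..ncons S})"
  shows "\<exists>\<alpha>. C_homomorphism (4 * real L)
           (A_cc k S) (weight_cc k S \<pi>) (A_cv k S) (weight_cv k S \<pi>') \<alpha>"
proof -
  interpret S: kary_constraint_system k S
    by fact
  \<comment> \<open>Keeps the index set in the form \<open>{1..ncons S}\<close>, so that terms
    containing it continue to match after simplification.\<close>
  note One_nat_def [simp del]
  let ?I = "{1..ncons S}" and ?V = "scope S" and ?C = "sat S"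
  let ?A = "factor k S" and ?B = "CZ_free k (vars S)"
  let ?G = "fp_generators ?I ?A" and ?R = "fp_relations ?I ?A"
  let ?G1 = "fp1_generators ?I ?A ?B" and ?R1 = "fp1_relations ?I ?A ?B"
  have V: "finite (?V i)" if "i \<in> ?I" for i
    using S.scope_vars[OF that] S.finite_vars by (rule finite_subset)
  have C: "?C i \<subseteq> ?V i \<rightarrow>\<^sub>E {0..<k}" "finite (?C i)" if "i \<in> ?I" for i
    using S.sat_scope[OF that] finite_PiE[OF V[OF that], of "\<lambda>_. {0..<k}"]
    by (auto intro: finite_subset)
  have A: "star_algebra (?A i)" if "i \<in> ?I" for i
    unfolding factor_def using S.k_pos V[OF that] C(1)[OF that] by (rule star_algebra_constraint_algebra)
  have U_FA: "unitary_relations k (vars S) \<subseteq> FA (vars S)"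
    by (auto simp: unitary_relations_def FA_gen)
  interpret U: free_image "vars S" ?B "proj (vars S) (unitary_relations k (vars S))"
    unfolding CZ_free_def using U_FA by (rule free_image_presented)
  note R = fp_relations_FA[of ?I ?A, OF A] and R1 = fp1_relations_FA[of ?I ?A, OF A U.star_algebra_B]
  interpret cc: free_image ?G "A_cc k S" "proj ?G ?R"
    unfolding A_cc_def free_product_def using R by (rule free_image_presented)
  interpret cv: free_image ?G1 "A_cv k S" "proj ?G1 ?R1"
    unfolding A_cv_def free_product1_def using R1 by (rule free_image_presented)
  obtain \<alpha> where \<alpha>: "star_hom (A_cc k S) (A_cv k S) \<alpha>"
    "\<And>f. f \<in> FA ?G \<Longrightarrow> \<alpha> (proj ?G ?R f) = proj ?G1 ?R1 (map_free Inl f)"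
    unfolding A_cc_def A_cv_def
    using free_product_into_free_product1[of ?I ?A, OF A U.star_algebra_B] by blast

  \<comment> \<open>\<open>p0\<close> and \<open>p\<close> represent the same projection in the two
    free products; renaming by \<open>Inl\<close> carries one to the other.\<close>
  define p0 where "p0 i \<phi> = gen (i, Phi k (?V i) (?C i) \<phi>)" for i \<phi>
  define p where "p i \<phi> = (gen (Inl (i, Phi k (?V i) (?C i) \<phi>)) ::
      (nat \<times> 'v free set set + 'v free set) free)" for i \<phi>
  \<comment> \<open>The generators of the free product are elements of its factors, so a variable
    enters as the letter attached to its class in \<open>CZ_free\<close>.\<close>
  define u where "u x = (gen (Inr (CZ_free_gen k (vars S) x)) ::
      (nat \<times> 'v free set set + 'v free set) free)" for x
  define Q where "Q x a = spectral k a (u x)" for x a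

  have p0_FA: "p0 i \<phi> \<in> FA ?G" if "i \<in> ?I" for i \<phi>
    unfolding p0_def fp_generators_def using Phi_closed[OF S.k_pos V[OF that] C(1)[OF that], of \<phi>] that
    by (intro FA_gen) (simp add: factor_def)
  have p: "cv.orthogonal_pvm (?C i) (p i)" if "i \<in> ?I" for i
    unfolding p_def
  proof (rule orthogonal_pvm_Phi[where e = "\<lambda>a. Inl (i, a)"])
    show "star_hom (constraint_algebra k (?V i) (?C i)) (A_cv k S) (\<lambda>a. proj ?G1 ?R1 (gen (Inl (i, a))))"
      unfolding factor_def[symmetric] A_cv_def free_product1_def using A that
      by (intro star_hom_presented_gen R1) (auto simp: fp1_relations_def fp1_generators_def)
    show "(\<lambda>a. Inl (i, a)) ` carrier (constraint_algebra k (?V i) (?C i)) \<subseteq> ?G1"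
      unfolding factor_def[symmetric] using that by (auto simp: fp1_generators_def)
  qed (use S.k_pos V C that cv.free_image_axioms in auto)
  have p_FA: "p i \<phi> \<in> FA ?G1" if "i \<in> ?I" "\<phi> \<in> ?C i" for i \<phi>
    using p[OF that(1)] that(2)
    by (intro cv.projection_FA) (auto simp: cv.orthogonal_pvm_def cv.pvm_def)

  have Q: "cv.pvm {..<k} (Q x)" and u_FA: "u x \<in> FA ?G1" if x: "x \<in> vars S" for x
  proof -
    let ?x = "CZ_free_gen k (vars S) x" and ?h = "\<lambda>a. proj ?G1 ?R1 (gen (Inr a))"
    have hom: "star_hom ?B (A_cv k S) ?h"
      unfolding A_cv_def free_product1_def
      by (intro star_hom_presented_gen R1 U.star_algebra_B) (auto simp: fp1_relations_def fp1_generators_def)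
    have x_eq: "?x = proj (vars S) (unitary_relations k (vars S)) (gen x)"
      by (simp add: CZ_free_gen_def presented_gen_def)
    have x_closed: "?x \<in> carrier ?B"
      unfolding x_eq using x by (intro U.q_hom(1) FA_gen)
    show u: "u x \<in> FA ?G1"
      unfolding u_def using x_closed by (intro FA_gen) (simp add: fp1_generators_def)
    have "U.eqv (adj_free (gen x) * gen x) 1" "U.eqv (gen x ^ k) 1"
      using x by (auto intro!: presented_eqv[OF U_FA] simp: FA_gen) (auto simp: unitary_relations_def)
    then have rel: "adj ?B ?x \<otimes>\<^bsub>?B\<^esub> ?x = \<one>\<^bsub>?B\<^esub>" "?x [^]\<^bsub>?B\<^esub> k = \<one>\<^bsub>?B\<^esub>"
      using x by (simp_all add: x_eq U.eqv_def U.q_hom U.q_power FA_gen)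
    \<comment> \<open>The unitary relations hold for the class of x in its own factor; the inclusion
      of that factor carries them to \<open>u x\<close>.\<close>
    have "proj ?G1 ?R1 (adj_free (u x) * u x) = ?h (adj ?B ?x \<otimes>\<^bsub>?B\<^esub> ?x)"
      using u x_closed U.B'.adj_closed[OF x_closed]
      by (simp add: cv.q_hom star_homD[OF hom]) (simp add: u_def)
    moreover have "proj ?G1 ?R1 (u x ^ k) = ?h (?x [^]\<^bsub>?B\<^esub> k)"
      unfolding star_hom_nat_pow[OF U.star_algebra_B hom x_closed] cv.q_power[OF u]
      by (simp add: u_def)
    ultimately have "cv.eqv (adj_free (u x) * u x) 1" "cv.eqv (u x ^ k) 1"
      using u by (simp_all add: cv.eqv_def rel star_homD(4)[OF hom] cv.q_hom(4))
    then show "cv.pvm {..<k} (Q x)"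
      unfolding Q_def using u S.k_pos by (intro cv.pvm_spectral)
  qed
  have Q_FA: "Q x a \<in> FA ?G1" if "x \<in> vars S" for x a
    unfolding Q_def using u_FA[OF that] by simp

  define T where "T = {(i, j, \<phi>, \<psi>). i \<in> ?I \<and> j \<in> ?I \<and> \<phi> \<in> ?C i \<and> \<psi> \<in> ?C j \<and>
    restrict \<phi> (?V i \<inter> ?V j) \<noteq> restrict \<psi> (?V i \<inter> ?V j)}"
  define T' where "T' = {(i, x, \<phi>). i \<in> ?I \<and> x \<in> ?V i \<and> \<phi> \<in> ?C i}"
  define e0 where "e0 = (\<lambda>(i, j, \<phi>, \<psi>). p0 i \<phi> * p0 j \<psi>)"
  define e where "e = (\<lambda>(i, x, \<phi>). p i \<phi> * (1 - Q x (\<phi> x)))"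
  define w where "w = (\<lambda>(i, j, \<phi> :: 'v \<Rightarrow> nat, \<psi> :: 'v \<Rightarrow> nat). pmf \<pi> (i, j))"
  define w' where "w' = (\<lambda>(i, x :: 'v, \<phi> :: 'v \<Rightarrow> nat). pmf \<pi>' i / real (card (?V i)))"
  have T_Sigma: "T = (SIGMA i:?I. SIGMA j:?I. SIGMA \<phi>:?C i.
      {\<psi> \<in> ?C j. restrict \<phi> (?V i \<inter> ?V j) \<noteq> restrict \<psi> (?V i \<inter> ?V j)})"
    by (auto simp: T_def)
  have T'_Sigma: "T' = (SIGMA i:?I. SIGMA x:?V i. ?C i)"
    by (auto simp: T'_def)
  have T: "finite T" and T': "finite T'"
    unfolding T_Sigma T'_Sigma using V C(2) by (intro finite_SigmaI; simp)+
  have e0_FA: "e0 t \<in> FA ?G" if "t \<in> T" for t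
    using that by (auto simp: e0_def T_def p0_FA)
  have e_FA: "e t \<in> FA ?G1" if "t \<in> T'" for t
    using that S.scope_vars by (auto simp: e_def T'_def p_FA Q_FA subset_iff)

  have weight_cc: "weight_cc k S \<pi> = listed_weight T w (\<lambda>t. proj ?G ?R (e0 t))"
    unfolding weight_cc_def T_def[symmetric] w_def
    by (rule listed_weight_cong)
      (auto simp: T_def e0_def cc.q_hom(3) p0_FA p0_def[symmetric] Phi_cc_def fp_incl_def presented_gen_def)
  have weight_cv: "weight_cv k S \<pi>' = listed_weight T' w' (\<lambda>t. proj ?G1 ?R1 (e t))"
    unfolding weight_cv_def T'_def[symmetric] w'_def
  proof (rule listed_weight_cong)
    fix t assume t: "t \<in> T'"
    obtain i x \<phi> where t_eq: "t = (i, x, \<phi>)"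
      by (cases t)
    then have i: "i \<in> ?I" and x: "x \<in> vars S" and \<phi>: "\<phi> \<in> ?C i"
      using t S.scope_vars by (auto simp: T'_def)
    have "var_cv k S x = proj ?G1 ?R1 (u x)" "Phi_cv k S i \<phi> = proj ?G1 ?R1 (p i \<phi>)"
      by (simp_all add: var_cv_def fp1_incl_last_def presented_gen_def u_def Phi_cv_def fp1_incl_def p_def)
    then show "(case t of (i, x, \<phi>) \<Rightarrow> Phi_cv k S i \<phi> \<otimes>\<^bsub>A_cv k S\<^esub>
        (\<one>\<^bsub>A_cv k S\<^esub> \<ominus>\<^bsub>A_cv k S\<^esub> spectral_proj k (A_cv k S) (\<phi> x) (var_cv k S x))) =
        proj ?G1 ?R1 (e t)"
      using u_FA[OF x] p_FA[OF i \<phi>]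
      by (simp add: t_eq e_def Q_def cv.q_hom(3,4) cv.q_diff cv.spectral_proj_eq)
  qed simp

  have "\<alpha> (weighted_square_sum (A_cc k S) (weight_cc k S \<pi>)) =
      \<alpha> (proj ?G ?R (\<Sum>t\<in>T. sc (of_real (w t)) * (adj_free (e0 t) * e0 t)))"
    unfolding weight_cc by (simp only: cc.weighted_square_sum_listed[OF T e0_FA])
  also have "\<dots> = proj ?G1 ?R1 (map_free Inl (\<Sum>t\<in>T. sc (of_real (w t)) * (adj_free (e0 t) * e0 t)))"
    by (intro \<alpha>(2) FA_sum FA_mult FA_adj FA_sc e0_FA)
  also have "map_free Inl (\<Sum>t\<in>T. sc (of_real (w t)) * (adj_free (e0 t) * e0 t)) =
      (\<Sum>(i, j, \<phi>, \<psi>)\<in>T. sc (of_real (pmf \<pi> (i, j))) * (adj_free (p i \<phi> * p j \<psi>) * (p i \<phi> * p j \<psi>)))"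
    unfolding map_free_sum
    by (intro sum.cong refl)
      (auto simp: map_free_mult map_free_adj map_free_single w_def e0_def p0_def p_def)
  also have "\<dots> = (\<Sum>i\<in>?I. \<Sum>j\<in>?I. sc (of_real (pmf \<pi> (i, j))) * (\<Sum>\<phi>\<in>?C i. \<Sum>\<psi>\<in>?C j.
      if restrict \<phi> (?V i \<inter> ?V j) \<noteq> restrict \<psi> (?V i \<inter> ?V j)
      then adj_free (p i \<phi> * p j \<psi>) * (p i \<phi> * p j \<psi>) else 0))"
  proof -
    \<comment> \<open>The disagreement condition moves from the index set into the summand, which is
      the shape used by the main inequality.\<close>
    have "(\<Sum>(i, j, \<phi>, \<psi>)\<in>T. h i j \<phi> \<psi>) = (\<Sum>i\<in>?I. \<Sum>j\<in>?I. \<Sum>\<phi>\<in>?C i. \<Sum>\<psi>\<in>?C j.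
        if restrict \<phi> (?V i \<inter> ?V j) \<noteq> restrict \<psi> (?V i \<inter> ?V j) then h i j \<phi> \<psi> else 0)"
      for h :: "nat \<Rightarrow> nat \<Rightarrow> _ \<Rightarrow> _ \<Rightarrow> (nat \<times> 'v free set set + 'v free set) free"
      unfolding T_Sigma using C(2)
      by (subst sum_over_Sigma4) (auto intro!: sum.cong sum.inter_filter)
    then show ?thesis
      by (simp add: sum_distrib_left if_distrib[of "(*) (sc _)"] cong: if_cong)
  qed
  finally have lhs: "\<alpha> (weighted_square_sum (A_cc k S) (weight_cc k S \<pi>)) = proj ?G1 ?R1
    (\<Sum>i\<in>?I. \<Sum>j\<in>?I. sc (of_real (pmf \<pi> (i, j))) * (\<Sum>\<phi>\<in>?C i. \<Sum>\<psi>\<in>?C j.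
      if restrict \<phi> (?V i \<inter> ?V j) \<noteq> restrict \<psi> (?V i \<inter> ?V j)
      then adj_free (p i \<phi> * p j \<psi>) * (p i \<phi> * p j \<psi>) else 0))" .

  \<comment> \<open>Here the weight of i under \<pi>' is replaced by the marginal of \<pi>, so both
    sides of the comparison are governed by the same weights.\<close>
  have "(\<Sum>t\<in>T'. sc (of_real (w' t)) * (adj_free (e t) * e t)) =
      (\<Sum>i\<in>?I. sc (of_real ((\<Sum>j\<in>?I. pmf \<pi> (i, j)) / card (?V i))) * (\<Sum>x\<in>?V i. \<Sum>\<phi>\<in>?C i.
        adj_free (p i \<phi> * (1 - Q x (\<phi> x))) * (p i \<phi> * (1 - Q x (\<phi> x)))))"
    unfolding T'_Sigma using V C(2)
    by (subst sum_over_Sigma3) (auto simp: w'_def e_def sum_distrib_left assms(5) intro!: sum.cong)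
  moreover have "module.smult (A_cv k S) (of_real (4 * real L))
      (weighted_square_sum (A_cv k S) (weight_cv k S \<pi>')) =
      proj ?G1 ?R1 (sc (of_real (4 * real L)) * (\<Sum>t\<in>T'. sc (of_real (w' t)) * (adj_free (e t) * e t)))"
  proof -
    have "weighted_square_sum (A_cv k S) (weight_cv k S \<pi>') =
        proj ?G1 ?R1 (\<Sum>t\<in>T'. sc (of_real (w' t)) * (adj_free (e t) * e t))"
      unfolding weight_cv by (simp only: cv.weighted_square_sum_listed[OF T' e_FA])
    then show ?thesis
      by (simp only:) (intro cv.q_hom(5)[symmetric] FA_sum FA_mult FA_adj FA_sc e_FA)
  qed
  ultimately have rhs: "module.smult (A_cv k S) (of_real (4 * real L))
      (weighted_square_sum (A_cv k S) (weight_cv k S \<pi>')) = proj ?G1 ?R1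
      (sc (of_real (4 * real L)) * (\<Sum>i\<in>?I. sc (of_real ((\<Sum>j\<in>?I. pmf \<pi> (i, j)) / card (?V i))) *
        (\<Sum>x\<in>?V i. \<Sum>\<phi>\<in>?C i.
          adj_free (p i \<phi> * (1 - Q x (\<phi> x))) * (p i \<phi> * (1 - Q x (\<phi> x))))))"
    by (simp only:)

  have "cyclic_le (A_cv k S) (\<alpha> (weighted_square_sum (A_cc k S) (weight_cc k S \<pi>)))
      (module.smult (A_cv k S) (of_real (4 * real L)) (weighted_square_sum (A_cv k S) (weight_cv k S \<pi>')))"
    unfolding lhs rhs
  proof (rule cv.cyclic_le_q, rule cv.weighted_consistency_le_defect)
    show "card (?V i) \<le> L" if "i \<in> ?I" for i
      unfolding assms(6) using that by (intro Max_ge) auto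
    show "\<phi> x < k" if "i \<in> ?I" "\<phi> \<in> ?C i" "x \<in> ?V i" for i \<phi> x
    proof -
      have "\<phi> \<in> ?V i \<rightarrow>\<^sub>E {0..<k}"
        using C(1)[OF that(1)] that(2) by blast
      then show ?thesis
        using that(3) by auto
    qed
    show "cv.pvm {..<k} (Q x)" if "i \<in> ?I" "x \<in> ?V i" for i x
      using S.scope_vars[OF that(1)] that(2) by (intro Q) auto
  qed (use p V assms(3) in auto)
  moreover have "weighted_star_algebra (A_cc k S) (weight_cc k S \<pi>)"
    unfolding weight_cc using T e0_FA cc.star_algebra_B
    by (intro weighted_star_algebra_listed cc.q_hom(1)) (auto simp: w_def)
  moreover have "weighted_star_algebra (A_cv k S) (weight_cv k S \<pi>')"
    unfolding weight_cv using T' e_FA cv.star_algebra_B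
    by (intro weighted_star_algebra_listed cv.q_hom(1)) (auto simp: w'_def)
  ultimately show ?thesis
    using \<alpha>(1) unfolding C_homomorphism_def by blast
qed

end
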